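(* Let $D=\mathbb{C}\setminus\{-it:t\ge 0\}$, let $e_k=\mathrm{e}^{-i\pi2^{-k}}$, and let $R_n$ and $R_{nk}$ ($n\ge1$, $k\ge 1$) be the remainders, functions of $x$, defined in the context. (i) For fixed $x\in D$ and large $n$, $R_n=O\big(2^{-n}n^{-\Im x/\pi}\big)$. For fixed $n$ and large $x$, $R_n=O(x^{-n})$. (ii) For fixed $k$ and $x\in D$, $R_{nk}=O\big(|1+e_k|^{-n}n^{-2^k\Im x/\pi}\big)$. For fixed $n$ and large $2^kx$, $R_{nk}=O\big((2^kx)^{-n}\big)$.
   Context: $(z)_m=z(z+1)\cdots(z+m-1)=\Gamma(z+m)/\Gamma(z)$ is the rising factorial, with $(z)_0=1$. Put $y=-ix/\pi$ and $e_k=\mathrm{e}^{-i\pi2^{-k}}$. For $x$ in the open first quadrant define $$R_n=-\frac{i\,\Gamma(n)}{(y)_{n-1}}\int_0^{\infty-i0}\frac{\mathrm{e}^{-ip(y+n-1)}}{(1+\mathrm{e}^{-ip})^n}\,dp,\qquad R_{nk}=\frac{i\,e_k\,\Gamma(n)}{(2^ky)_{n-1}}\int_0^{\infty-i0}\frac{\mathrm{e}^{-ip(2^ky+n-1)}}{(e_k+\mathrm{e}^{-ip})^n}\,dp ,$$ where the path goes from $0$ to infinity below the positive real axis (e.g. $[0,-i]$ followed by $-i+\mathbb{R}^+$). The remainders are then continued analytically in $x$ (on the Riemann surface of the logarithm); here they are considered for $x\in D$. They are the remainders in $$\mathrm{e}^{-x}\mathrm{Ei}^+(x)=-\sum_{m=1}^{n-1}\frac{\Gamma(m)}{2^m(y)_m}+R_n+\sum_{k=1}^\infty\left(\sum_{m=1}^{n-1}\frac{\Gamma(m)e_k}{(1+e_k)^m(2^ky)_m}+R_{nk}\right),$$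 where $\mathrm{e}^{-x}\mathrm{Ei}^+(x)=\int_0^{\infty-i0}\frac{\mathrm{e}^{-px}}{1-p}dp$ for $x$ in the first quadrant, the path passing below $p=1$, and by analytic continuation otherwise.
   Formalization: For fixed n, the bounds for large x and large 2^k x are stated uniformly in each closed subsector |Arg(-ix)| ≤ π-δ (δ>0) of D rather than on all of D, where they fail because the remainders have poles on the removed half-line. *)

theory Defs
  imports "HOL-Complex_Analysis.Complex_Analysis" "HOL-Library.Landau_Symbols"
begin

definition slit_plane :: "complex set" where
  "slit_plane = - {- \<i> * complex_of_real t |t. t \<ge> 0}"

definition open_first_quadrant :: "complex set" where
  "open_first_quadrant = {x. Re x > 0 \<and> Im x > 0}"

text \<open>The integral from \<open>0\<close> to \<open>\<infinity> - i0\<close>, along \<open>[0, -i]\<close> followed by the half-line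
  \<open>-i + [0, \<infinity>)\<close>.\<close>
definition integral_below :: "(complex \<Rightarrow> complex) \<Rightarrow> complex" where
  "integral_below f =
     contour_integral (linepath 0 (- \<i>)) f + integral {0..} (\<lambda>t. f (complex_of_real t - \<i>))"

text \<open>The holomorphic extension to \<open>D\<close> of a function given on \<open>U\<close>. When \<open>D\<close> is open and connected
  and \<open>U \<subseteq> D\<close> is open and nonempty, any such extension is unique on \<open>D\<close>; outside \<open>D\<close>
  its values carry no meaning.\<close>
definition analytic_extension ::
    "complex set \<Rightarrow> complex set \<Rightarrow> (complex \<Rightarrow> complex) \<Rightarrow> complex \<Rightarrow> complex" where
  "analytic_extension U D f = (SOME g. g holomorphic_on D \<and> (\<forall>x\<in>U. g x = f x))"

lemma analytic_extension_eq:
  assumes "open D" "connected D" "open U" "U \<noteq> {}" "U \<subseteq> D"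
    and "g holomorphic_on D" "\<And>x. x \<in> U \<Longrightarrow> g x = f x" "x \<in> D"
  shows "analytic_extension U D f x = g x"
proof -
  let ?P = "\<lambda>g. g holomorphic_on D \<and> (\<forall>x\<in>U. g x = f x)"
  have "?P (analytic_extension U D f)"
    unfolding analytic_extension_def by (rule someI[of ?P g]) (use assms in auto)
  then show ?thesis
    using analytic_continuation_open[of U D "analytic_extension U D f" g x] assms by auto
qed

definition yvar :: "complex \<Rightarrow> complex" where
  "yvar x = - \<i> * x / complex_of_real pi"

definition ek :: "nat \<Rightarrow> complex" where
  "ek k = exp (- \<i> * complex_of_real pi / 2 ^ k)"

definition R_integral :: "nat \<Rightarrow> complex \<Rightarrow> complex" where
  "R_integral n x =
     - (\<i> * Gamma (of_nat n) / pochhammer (yvar x) (n - 1)) *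
       integral_below (\<lambda>p. exp (- \<i> * p * (yvar x + of_nat n - 1)) / (1 + exp (- \<i> * p)) ^ n)"

definition Rk_integral :: "nat \<Rightarrow> nat \<Rightarrow> complex \<Rightarrow> complex" where
  "Rk_integral n k x =
     \<i> * ek k * Gamma (of_nat n) / pochhammer (2 ^ k * yvar x) (n - 1) *
       integral_below (\<lambda>p. exp (- \<i> * p * (2 ^ k * yvar x + of_nat n - 1)) / (ek k + exp (- \<i> * p)) ^ n)"

definition R :: "nat \<Rightarrow> complex \<Rightarrow> complex" where
  "R n = analytic_extension open_first_quadrant slit_plane (R_integral n)"

definition Rk :: "nat \<Rightarrow> nat \<Rightarrow> complex \<Rightarrow> complex" where
  "Rk n k = analytic_extension open_first_quadrant slit_plane (Rk_integral n k)"

text \<open>The closed subsectors of the slit plane, in which the large-argument estimates are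
  uniform. They cannot be uniform on the whole slit plane: the continued remainders have poles on
  the removed half-line, accumulating only at infinity. The factor \<open>-i\<close> turns that
  half-line into the negative real axis, where the principal argument is \<open>\<pi>\<close>.\<close>
definition closed_sector :: "real \<Rightarrow> complex set" where
  "closed_sector \<delta> = {x. x \<noteq> 0 \<and> \<bar>Arg (- \<i> * x)\<bar> \<le> pi - \<delta>}"

end

theory Submission
  imports Defs "HOL-Real_Asymp.Real_Asymp"
begin

text \<open>
  Put \<open>z = 2\<^sup>k y\<close> and \<open>\<tau> = i p\<close>. Cauchy's theorem moves the path onto the ray
  \<open>\<tau> \<ge> 0\<close>, so up to sign every remainder is
  \<open>e \<Gamma>(n) / (z)\<^bsub>n-1\<^esub>\<close> times the Laplace transform at \<open>z + n - 1\<close> of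
  \<open>(e + exp (-\<tau>))\<^sup>-\<^sup>n\<close>, with \<open>e = 1\<close> or \<open>e = e\<^sub>k\<close>. Integration by parts
  raises \<open>n\<close> at the cost of one term of the expansion, which continues the remainder to the plane
  cut along the negative axis and shows that for fixed \<open>z\<close> and large \<open>n\<close> the integral formula
  itself is valid. The large \<open>n\<close> estimate is then
  \<open>|e + exp (-\<tau>)| \<ge> |1 + e| exp (-\<tau>/2)\<close> combined with Euler's limit for \<open>\<Gamma>(z)\<close>. For
  large \<open>z\<close> the ray is turned by an angle smaller than a right angle, which represents the
  continuation on a rotated half-plane; the integrand has no poles in the right half-plane, and on
  a cone the distance of \<open>exp (-\<tau>)\<close> from \<open>-e\<close> is bounded below uniformly for \<open>e\<close> in the
  quarter circle from \<open>-i\<close> to \<open>1\<close>, which contains \<open>1\<close> and all \<open>e\<^sub>k\<close>.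
\<close>

section \<open>Exponentially decaying integrals and Laplace transforms\<close>

lemma exp_decay_integral:
  fixes f :: "real \<Rightarrow> complex"
  assumes f: "continuous_on {a..} f" and c: "c > 0"
    and bound: "\<And>t. t \<ge> a \<Longrightarrow> norm (f t) \<le> B * exp (- c * t)"
  shows exp_decay_integrable: "f integrable_on {a..}"
    and norm_exp_decay_integral_le: "norm (integral {a..} f) \<le> B * (exp (- c * a) / c)"
proof -
  have i: "((\<lambda>t. B * exp (- c * t)) has_integral B * (exp (- c * a) / c)) {a..}"
    by (intro has_integral_mult_right has_integral_exp_minus_to_infinity c)
  show int: "f integrable_on {a..}"
  proof (rule measurable_bounded_by_integrable_imp_integrable)
    show "f \<in> borel_measurable (lebesgue_on {a..})"
      by (rule continuous_imp_measurable_on_sets_lebesgue[OF f]) auto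
  qed (use i bound in auto)
  have "norm (integral {a..} f) \<le> integral {a..} (\<lambda>t. B * exp (- c * t))"
    by (rule Henstock_Kurzweil_Integration.integral_norm_bound_integral[OF int])
      (use i bound in auto)
  then show "norm (integral {a..} f) \<le> B * (exp (- c * a) / c)"
    by (simp only: integral_unique[OF i])
qed

lemma exp_decay_integral_split:
  fixes f :: "real \<Rightarrow> complex"
  assumes f: "continuous_on {0..} f" and c: "c > 0"
    and bound: "\<And>t. t \<ge> 0 \<Longrightarrow> norm (f t) \<le> B * exp (- c * t)" and T: "T \<ge> 0"
  shows "integral {0..} f = integral {0..T} f + integral {T..} f"
proof -
  have "{0..} = {0..T} \<union> {T..}" using T by auto
  moreover have "integral ({0..T} \<union> {T..}) f = integral {0..T} f + integral {T..} f"
  proof (rule Henstock_Kurzweil_Integration.integral_Un)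
    show "f integrable_on {0..T}"
      by (rule integrable_continuous_interval) (rule continuous_on_subset[OF f], auto)
    show "f integrable_on {T..}"
      by (rule exp_decay_integrable[OF _ c bound]) (use T in \<open>auto intro: continuous_on_subset[OF f]\<close>)
    have "{0..T} \<inter> {T..} = {T}" using T by auto
    then show "negligible ({0..T} \<inter> {T..})" by simp
  qed
  ultimately show ?thesis by simp
qed

lemma exp_decay_integral_tail:
  fixes f :: "real \<Rightarrow> complex"
  assumes f: "continuous_on {0..} f" and c: "c > 0"
    and bound: "\<And>t. t \<ge> 0 \<Longrightarrow> norm (f t) \<le> B * exp (- c * t)" and T: "T \<ge> 0"
  shows "norm (integral {0..} f - integral {0..T} f) \<le> B * (exp (- c * T) / c)"
proof -
  have "norm (integral {T..} f) \<le> B * (exp (- c * T) / c)"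
    by (rule norm_exp_decay_integral_le[OF _ c bound])
      (use T in \<open>auto intro: continuous_on_subset[OF f]\<close>)
  then show ?thesis using exp_decay_integral_split[OF f c bound T] by simp
qed

text \<open>Integer cutoffs let identities proved on compact intervals pass to the half-line by
  uniqueness of limits.\<close>

lemma exp_decay_integral_tendsto:
  fixes f :: "real \<Rightarrow> complex"
  assumes f: "continuous_on {0..} f" and c: "c > 0"
    and bound: "\<And>t. t \<ge> 0 \<Longrightarrow> norm (f t) \<le> B * exp (- c * t)"
  shows "(\<lambda>N. integral {0..real N} f) \<longlonglongrightarrow> integral {0..} f"
proof (rule LIM_zero_cancel, rule Lim_null_comparison)
  show "\<forall>\<^sub>F N in sequentially.
      norm (integral {0..real N} f - integral {0..} f) \<le> B * (exp (- c * real N) / c)"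
    using exp_decay_integral_tail[OF f c bound] by (simp only: norm_minus_commute) simp
  show "(\<lambda>N. B * (exp (- c * real N) / c)) \<longlonglongrightarrow> 0"
    using c by real_asymp
qed

section \<open>Laplace transforms of bounded functions\<close>

definition lap :: "(real \<Rightarrow> complex) \<Rightarrow> complex \<Rightarrow> complex" where
  "lap g z = integral {0..} (\<lambda>t. g t * exp (- (of_real t * z)))"

lemma norm_lap_integrand_le:
  fixes g :: "real \<Rightarrow> complex"
  assumes "\<And>t. t \<ge> 0 \<Longrightarrow> norm (g t) \<le> B" "t \<ge> 0" "c \<le> Re z"
  shows "norm (g t * exp (- (of_real t * z))) \<le> B * exp (- c * t)"
proof -
  have "B \<ge> 0" using assms(1)[of 0] norm_ge_zero order_trans by blast
  moreover have "- (t * Re z) \<le> - c * t"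
    using mult_right_mono[OF assms(3,2)] by (simp add: mult.commute)
  ultimately show ?thesis
    using assms(1)[OF assms(2)] by (simp add: norm_mult mult_mono)
qed

lemma continuous_on_lap_integrand:
  fixes g :: "real \<Rightarrow> complex"
  shows "continuous_on S g \<Longrightarrow> continuous_on S (\<lambda>t. g t * exp (- (of_real t * z)))"
  by (intro continuous_intros)

lemma norm_lap_le:
  assumes "continuous_on {0..} g" "\<And>t. t \<ge> 0 \<Longrightarrow> norm (g t) \<le> B" "Re z > 0"
  shows "norm (lap g z) \<le> B / Re z"
proof -
  have "norm (g t * exp (- (of_real t * z))) \<le> B * exp (- Re z * t)" if "t \<ge> 0" for t
    by (rule norm_lap_integrand_le) (use assms that in auto)
  from norm_exp_decay_integral_le[OF continuous_on_lap_integrand[OF assms(1)] assms(3) this]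
  show ?thesis by (simp add: lap_def)
qed

text \<open>The truncations to \<open>{0..N}\<close> are holomorphic by differentiation under the
  integral sign, and they converge uniformly near each point because the tails share one exponential
  rate.\<close>

lemma holomorphic_lap:
  assumes g: "continuous_on {0..} g" and B: "\<And>t. t \<ge> 0 \<Longrightarrow> norm (g t) \<le> B"
  shows "lap g holomorphic_on {z. Re z > 0}"
proof -
  let ?f = "\<lambda>z t. g t * exp (- (of_real t * z))"
  define F where "F = (\<lambda>N::nat. \<lambda>z. integral {0..real N} (?f z))"
  have contg: "continuous_on {0..real N} g" for N
    by (rule continuous_on_subset[OF g]) auto
  have B0: "B \<ge> 0" using B[of 0] norm_ge_zero order_trans by blast
  show ?thesis
  proof (rule holomorphic_uniform_sequence[where f = F])
    show "open {z. 0 < Re z}" by (rule open_halfspace_Re_gt)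
    show "F N holomorphic_on {z. 0 < Re z}" for N
    proof -
      have "(\<lambda>z. integral (cbox 0 (real N)) (?f z)) holomorphic_on {z. 0 < Re z}"
      proof (rule leibniz_rule_holomorphic[where fx = "\<lambda>z t. g t * (exp (- (of_real t * z)) * (- of_real t))"])
        show "((\<lambda>z. ?f z t) has_field_derivative g t * (exp (- (of_real t * z)) * (- of_real t)))
            (at z within {z. 0 < Re z})" for z t
          by (auto intro!: derivative_eq_intros)
        show "?f z integrable_on cbox 0 (real N)" for z
          using integrable_continuous_interval[OF continuous_on_lap_integrand[OF contg]] by simp
        have "continuous_on ({z. 0 < Re z} \<times> cbox 0 (real N)) (\<lambda>x. g (snd x))"
          by (rule continuous_on_compose2[OF contg]) (auto intro!: continuous_intros)
        then show "continuous_on ({z. 0 < Re z} \<times> cbox 0 (real N))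
            (\<lambda>(z, t). g t * (exp (- (of_real t * z)) * (- of_real t)))"
          by (auto simp: case_prod_unfold intro!: continuous_intros)
        show "convex {z. 0 < Re z}" by (rule convex_halfspace_Re_gt)
      qed
      then show ?thesis by (simp add: F_def)
    qed
    fix z :: complex assume "z \<in> {z. 0 < Re z}"
    \<comment> \<open>With this radius \<open>Re w\<close> is at least \<open>d\<close> on the whole
      ball, which is the common rate of the tails.\<close>
    define d where "d = Re z / 2"
    have d: "d > 0" using \<open>z \<in> _\<close> by (simp add: d_def)
    have Re_d: "d \<le> Re w" if "w \<in> cball z d" for w
      using that abs_Re_le_cmod[of "z - w"] by (auto simp: d_def dist_norm)
    have tail: "norm (F N w - lap g w) \<le> B * (exp (- d * real N) / d)" if "w \<in> cball z d" for N w
    proof -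
      have "norm (?f w t) \<le> B * exp (- d * t)" if "t \<ge> 0" for t
        by (rule norm_lap_integrand_le[OF B that Re_d[OF \<open>w \<in> cball z d\<close>]])
      from exp_decay_integral_tail[OF continuous_on_lap_integrand[OF g, of w] d this, of "real N"]
      show ?thesis by (simp add: F_def lap_def norm_minus_commute)
    qed
    have lim: "(\<lambda>N. B * (exp (- d * real N) / d)) \<longlonglongrightarrow> 0"
      using d by real_asymp
    have "uniform_limit (cball z d) F (lap g) sequentially"
    proof (rule uniform_limitI)
      fix \<epsilon> :: real assume "\<epsilon> > 0"
      then have "\<forall>\<^sub>F N in sequentially. B * (exp (- d * real N) / d) < \<epsilon>"
        using order_tendstoD(2)[OF lim] by blast
      then show "\<forall>\<^sub>F N in sequentially. \<forall>w\<in>cball z d. dist (F N w) (lap g w) < \<epsilon>"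
        by eventually_elim (auto simp: dist_norm intro!: le_less_trans[OF tail])
    qed
    moreover have "cball z d \<subseteq> {z. 0 < Re z}"
      using Re_d d by fastforce
    ultimately show "\<exists>d>0. cball z d \<subseteq> {z. 0 < Re z} \<and> uniform_limit (cball z d) F (lap g) sequentially"
      using d by blast
  qed
qed

text \<open>The product rule is integrated over \<open>{0..N}\<close>. Since \<open>g\<close> is
  bounded, the boundary term at \<open>N\<close> decays like \<open>exp (- Re z * N)\<close>, so
  only \<open>g 0\<close> survives in the limit.\<close>

lemma lap_integration_by_parts:
  assumes g: "\<And>t. t \<ge> 0 \<Longrightarrow> (g has_vector_derivative g' t) (at t within {0..})"
    and g': "continuous_on {0..} g'"
    and B: "\<And>t. t \<ge> 0 \<Longrightarrow> norm (g t) \<le> B" and B': "\<And>t. t \<ge> 0 \<Longrightarrow> norm (g' t) \<le> B'"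
    and z: "Re z > 0"
  shows "z * lap g z = g 0 + lap g' z"
proof -
  let ?e = "\<lambda>t. exp (- (of_real t * z))"
  have contg: "continuous_on {0..} g"
    using g by (force simp: continuous_on_eq_continuous_within intro: has_vector_derivative_continuous)
  have lims: "(\<lambda>N. integral {0..real N} (\<lambda>t. h t * ?e t)) \<longlonglongrightarrow> lap h z"
    if "continuous_on {0..} h" "\<And>t. t \<ge> 0 \<Longrightarrow> norm (h t) \<le> C" for h C
    unfolding lap_def
  proof (rule exp_decay_integral_tendsto[OF continuous_on_lap_integrand[OF that(1)] z])
    show "norm (h t * ?e t) \<le> C * exp (- Re z * t)" if "t \<ge> 0" for t
      by (rule norm_lap_integrand_le) (use that \<open>\<And>t. t \<ge> 0 \<Longrightarrow> norm (h t) \<le> C\<close> in auto)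
  qed
  have parts: "integral {0..real N} (\<lambda>t. g' t * ?e t) =
      g (real N) * ?e (real N) - g 0 + z * integral {0..real N} (\<lambda>t. g t * ?e t)" for N
  proof -
    have int: "(\<lambda>t. h t * ?e t) integrable_on {0..real N}" if "continuous_on {0..} h" for h
      by (rule integrable_continuous_interval, rule continuous_on_lap_integrand,
          rule continuous_on_subset[OF that]) auto
    have e: "(?e has_vector_derivative (- z) * ?e t) (at t within {0..real N})" for t
      by (rule has_vector_derivative_real_field) (auto intro!: derivative_eq_intros)
    have "((\<lambda>t. g' t * ?e t - z * (g t * ?e t)) has_integral (g (real N) * ?e (real N) - g 0 * ?e 0))
        {0..real N}"
    proof (rule fundamental_theorem_of_calculus)
      fix t assume t: "t \<in> {0..real N}"
      have "(g has_vector_derivative g' t) (at t within {0..real N})"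
        by (rule has_vector_derivative_within_subset[OF g]) (use t in auto)
      from has_vector_derivative_mult[OF this e]
      show "((\<lambda>t. g t * ?e t) has_vector_derivative g' t * ?e t - z * (g t * ?e t))
          (at t within {0..real N})"
        by (simp add: algebra_simps)
    qed simp
    then have "integral {0..real N} (\<lambda>t. g' t * ?e t - z * (g t * ?e t)) = g (real N) * ?e (real N) - g 0"
      by (simp add: integral_unique)
    moreover have "integral {0..real N} (\<lambda>t. g' t * ?e t - z * (g t * ?e t)) =
        integral {0..real N} (\<lambda>t. g' t * ?e t) - z * integral {0..real N} (\<lambda>t. g t * ?e t)"
      using int[OF g'] int[OF contg] by (subst Henstock_Kurzweil_Integration.integral_diff) (auto intro: integrable_on_mult_right)
    ultimately show ?thesis by (simp only: diff_eq_eq)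
  qed
  have "(\<lambda>N. g (real N) * ?e (real N)) \<longlonglongrightarrow> 0"
  proof (rule Lim_null_comparison)
    show "\<forall>\<^sub>F N in sequentially. norm (g (real N) * ?e (real N)) \<le> B * exp (- Re z * real N)"
      by (intro always_eventually allI norm_lap_integrand_le[OF B]) auto
    show "(\<lambda>N. B * exp (- Re z * real N)) \<longlonglongrightarrow> 0"
      using z by real_asymp
  qed
  from tendsto_add[OF tendsto_diff[OF this tendsto_const[of "g 0"]]
      tendsto_mult[OF tendsto_const[of z] lims[OF contg B]]]
  have "(\<lambda>N. integral {0..real N} (\<lambda>t. g' t * ?e t)) \<longlonglongrightarrow> 0 - g 0 + z * lap g z"
    unfolding parts .
  from LIMSEQ_unique[OF this lims[OF g' B']] show ?thesis by (simp add: algebra_simps)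
qed

section \<open>Contour integrals along rays\<close>

lemma integral_linepath_ray:
  assumes f: "continuous_on {0..} (\<lambda>r. f (c + of_real r * a))" and T: "T > 0"
    and int: "f contour_integrable_on linepath c (c + of_real T * a)"
  shows "contour_integral (linepath c (c + of_real T * a)) f =
    a * integral {0..T} (\<lambda>r. f (c + of_real r * a))"
proof -
  let ?h = "\<lambda>r. f (c + of_real r * a)"
  have "?h integrable_on {0..T}"
    by (rule integrable_continuous_interval) (rule continuous_on_subset[OF f], auto)
  then have "((\<lambda>x. ?h (T * x)) has_integral (1 / \<bar>T\<bar>) *\<^sub>R integral {0..T} ?h) ((\<lambda>x. x / T) ` {0..T})"
    using T by (intro has_integral_stretch_real integrable_integral) auto
  moreover have "(\<lambda>x. x / T) ` {0..T} = {0..1}"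
    using T by (subst image_divide_atLeastAtMost) auto
  ultimately have "((\<lambda>x. ?h (T * x) * (of_real T * a)) has_integral
      (1 / T) *\<^sub>R integral {0..T} ?h * (of_real T * a)) {0..1}"
    using T by (intro has_integral_mult_left) auto
  then have "(f has_contour_integral (a * integral {0..T} ?h)) (linepath c (c + of_real T * a))"
    unfolding has_contour_integral_linepath using T
    by (simp add: linepath_def scaleR_conv_of_real algebra_simps)
  then show ?thesis by (rule contour_integral_unique)
qed

text \<open>The two rays from \<open>c\<close> are cut off at parameter \<open>N\<close> and joined by a chord rather than an
  arc, so that Cauchy's theorem for triangles applies.\<close>
lemma ray_rotation:
  assumes S: "convex S" and hol: "f holomorphic_on S"
    and sector: "\<And>s t. \<lbrakk>s \<ge> 0; t \<ge> 0\<rbrakk> \<Longrightarrow> c + of_real s * a + of_real t * b \<in> S"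
    and \<kappa>: "\<kappa> > 0"
    and decay: "\<And>s t. \<lbrakk>s \<ge> 0; t \<ge> 0\<rbrakk> \<Longrightarrow>
      norm (f (c + of_real s * a + of_real t * b)) \<le> B * exp (- \<kappa> * (s + t))"
  shows "a * integral {0..} (\<lambda>r. f (c + of_real r * a)) = b * integral {0..} (\<lambda>r. f (c + of_real r * b))"
proof -
  let ?A = "\<lambda>r. f (c + of_real r * a)" and ?B = "\<lambda>r. f (c + of_real r * b)"
  have contf: "continuous_on S f" by (rule holomorphic_on_imp_continuous_on[OF hol])
  have A: "continuous_on {0..} ?A"
    by (rule continuous_on_compose2[OF contf]) (use sector[of _ 0] in \<open>auto intro!: continuous_intros\<close>)
  have B: "continuous_on {0..} ?B"
    by (rule continuous_on_compose2[OF contf]) (use sector[of 0] in \<open>auto intro!: continuous_intros\<close>)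
  have limA: "(\<lambda>N. integral {0..real N} ?A) \<longlonglongrightarrow> integral {0..} ?A"
    by (rule exp_decay_integral_tendsto[OF A \<kappa>]) (use decay[of _ 0] in auto)
  have limB: "(\<lambda>N. integral {0..real N} ?B) \<longlonglongrightarrow> integral {0..} ?B"
    by (rule exp_decay_integral_tendsto[OF B \<kappa>]) (use decay[of 0] in auto)
  have B0: "B \<ge> 0" using order_trans[OF norm_ge_zero decay[of 0 0]] by simp
  have close: "norm (a * integral {0..real N} ?A - b * integral {0..real N} ?B)
      \<le> B * exp (- \<kappa> * real N) * (real N * norm (b - a))" if N: "N > 0" for N
  proof -
    let ?P = "c + of_real (real N) * a" and ?Q = "c + of_real (real N) * b"
    have inS: "c \<in> S" "?P \<in> S" "?Q \<in> S"
      using sector[of 0 0] sector[of "real N" 0] sector[of 0 "real N"] by auto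
    have "convex hull {c, ?P, ?Q} \<subseteq> S"
      by (rule hull_minimal) (use inS S in auto)
    then have "(f has_contour_integral 0) (linepath c ?P +++ linepath ?P ?Q +++ linepath ?Q c)"
      by (intro Cauchy_theorem_triangle holomorphic_on_subset[OF hol])
    moreover have ci: "f contour_integrable_on linepath u v" if "u \<in> S" "v \<in> S" for u v
      by (rule contour_integrable_continuous_linepath, rule continuous_on_subset[OF contf])
        (use that S in \<open>auto simp: closed_segment_subset\<close>)
    ultimately have "contour_integral (linepath c ?P) f + (contour_integral (linepath ?P ?Q) f
        + contour_integral (linepath ?Q c) f) = 0"
      using inS by (auto dest!: contour_integral_unique)
    moreover have "contour_integral (linepath ?Q c) f = - contour_integral (linepath c ?Q) f"
      using contour_integral_reverse_linepath[OF continuous_on_subset[OF contf], of ?Q c]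
        inS S by (simp add: closed_segment_subset)
    ultimately have "a * integral {0..real N} ?A - b * integral {0..real N} ?B
        = - contour_integral (linepath ?P ?Q) f"
      using integral_linepath_ray[OF A, of "real N"] integral_linepath_ray[OF B, of "real N"] N ci inS
      by (simp add: algebra_simps add_eq_0_iff2)
    moreover have "norm (contour_integral (linepath ?P ?Q) f) \<le> B * exp (- \<kappa> * real N) * norm (?Q - ?P)"
    proof (rule contour_integral_bound_linepath)
      fix w assume "w \<in> closed_segment ?P ?Q"
      then obtain u where u: "0 \<le> u" "u \<le> 1" "w = (1 - u) *\<^sub>R ?P + u *\<^sub>R ?Q"
        by (auto simp: in_segment)
      \<comment> \<open>The two coefficients on the chord add up to \<open>N\<close>, so the
        integrand there is at most \<open>B * exp (- \<kappa> * N)\<close>. This beats the chord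
        length, which grows only linearly.\<close>
      then have "w = c + of_real ((1 - u) * real N) * a + of_real (u * real N) * b"
        by (simp add: scaleR_conv_of_real algebra_simps)
      then have "norm (f w) \<le> B * exp (- \<kappa> * ((1 - u) * real N + u * real N))"
        using decay[of "(1 - u) * real N" "u * real N"] u by simp
      then show "norm (f w) \<le> B * exp (- \<kappa> * real N)" by (simp add: algebra_simps)
    qed (use B0 ci inS in auto)
    moreover have "norm (?Q - ?P) = real N * norm (b - a)"
      by (simp flip: norm_mult add: norm_mult right_diff_distrib)
        (metis norm_mult norm_of_nat right_diff_distrib)
    ultimately show ?thesis by simp
  qed
  have "(\<lambda>N. a * integral {0..real N} ?A - b * integral {0..real N} ?B) \<longlonglongrightarrow> 0"
  proof (rule Lim_null_comparison)
    show "\<forall>\<^sub>F N in sequentially. norm (a * integral {0..real N} ?A - b * integral {0..real N} ?B)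
        \<le> B * exp (- \<kappa> * real N) * (real N * norm (b - a))"
      using eventually_gt_at_top[of 0] by eventually_elim (rule close)
    show "(\<lambda>N. B * exp (- \<kappa> * real N) * (real N * norm (b - a))) \<longlonglongrightarrow> 0"
      using \<kappa> by real_asymp
  qed
  moreover have "(\<lambda>N. a * integral {0..real N} ?A - b * integral {0..real N} ?B) \<longlonglongrightarrow>
      a * integral {0..} ?A - b * integral {0..} ?B"
    by (intro tendsto_intros limA limB)
  ultimately show ?thesis using LIMSEQ_unique by force
qed

text \<open>Translation by 1 turns the cutoff \<open>N\<close> into \<open>Suc N\<close>, so the
  split on compact intervals passes to the limit.\<close>

lemma exp_decay_integral_shift:
  fixes f :: "real \<Rightarrow> complex"
  assumes f: "continuous_on {0..} f" and c: "c > 0"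
    and bound: "\<And>t. t \<ge> 0 \<Longrightarrow> norm (f t) \<le> B * exp (- c * t)"
  shows "integral {0..} f = integral {0..1} f + integral {0..} (\<lambda>t. f (1 + t))"
proof -
  have B: "B \<ge> 0" using order_trans[OF norm_ge_zero bound[of 0]] by simp
  have lim: "(\<lambda>N. integral {0..real N} (\<lambda>t. f (1 + t))) \<longlonglongrightarrow> integral {0..} (\<lambda>t. f (1 + t))"
  proof (rule exp_decay_integral_tendsto[OF _ c])
    show "continuous_on {0..} (\<lambda>t. f (1 + t))"
      by (rule continuous_on_compose2[OF f]) (auto intro!: continuous_intros)
    fix t :: real assume t: "t \<ge> 0"
    then have "norm (f (1 + t)) \<le> B * exp (- c * (1 + t))" by (intro bound) auto
    also have "\<dots> \<le> B * exp (- c * t)" using B c by (intro mult_left_mono) auto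
    finally show "norm (f (1 + t)) \<le> B * exp (- c * t)" .
  qed
  have shift: "integral {0..real N} (\<lambda>t. f (1 + t)) = integral {0..real (Suc N)} f - integral {0..1} f" for N
  proof -
    have "integral {0..real N} (\<lambda>t. f (1 + t)) = integral {1..real (Suc N)} f"
      using integral_shift_Icc_real[of 0 "real N" f 1] by (simp add: o_def add.commute)
    moreover have "integral {0..1} f + integral {1..real (Suc N)} f = integral {0..real (Suc N)} f"
      by (rule Henstock_Kurzweil_Integration.integral_combine)
        (auto intro!: integrable_continuous_interval intro: continuous_on_subset[OF f])
    ultimately show ?thesis by (simp add: algebra_simps)
  qed
  have "(\<lambda>N. integral {0..real (Suc N)} f - integral {0..1} f) \<longlonglongrightarrow> integral {0..} f - integral {0..1} f"
    by (intro tendsto_intros LIMSEQ_Suc exp_decay_integral_tendsto[OF f c bound])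
  from LIMSEQ_unique[OF lim[unfolded shift] this]
  show ?thesis by simp
qed

section \<open>The continued remainder\<close>

definition quarter_arc :: "complex set" where
  "quarter_arc = {e. norm e = 1 \<and> Re e \<ge> 0 \<and> Im e \<le> 0}"

text \<open>As \<open>Re e\<close> and \<open>s\<close> are nonnegative, the shift can only enlarge
  the real part.\<close>

lemma norm_quarter_arc_add_ge_one:
  assumes "e \<in> quarter_arc" "s \<ge> 0"
  shows "norm (e + of_real s) \<ge> 1"
proof -
  have "1 = (norm e)\<^sup>2" using assms by (simp add: quarter_arc_def)
  also have "\<dots> = (Re e)\<^sup>2 + (Im e)\<^sup>2" by (rule cmod_power2)
  also have "\<dots> \<le> (Re e + s)\<^sup>2 + (Im e)\<^sup>2"
    using assms by (intro add_right_mono power_mono) (auto simp: quarter_arc_def)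
  also have "\<dots> = (norm (e + of_real s))\<^sup>2" by (simp add: cmod_power2)
  finally have "1\<^sup>2 \<le> (norm (e + of_real s))\<^sup>2" by simp
  then show ?thesis by (rule power2_le_imp_le) simp
qed

text \<open>Both \<open>Re e\<close> and \<open>- Im e\<close> are nonnegative, so the cross term in
  the square of their sum is too. The sum measures the component of \<open>e\<close> in the
  direction \<open>1 - i\<close>.\<close>

lemma quarter_arc_sum_ge_one:
  assumes "e \<in> quarter_arc"
  shows "Re e - Im e \<ge> 1"
proof -
  have "1 = (norm e)\<^sup>2" using assms by (simp add: quarter_arc_def)
  also have "\<dots> = (Re e)\<^sup>2 + (Im e)\<^sup>2" by (rule cmod_power2)
  also have "\<dots> \<le> (Re e - Im e)\<^sup>2"
    using assms mult_nonneg_nonneg[of "Re e" "- Im e"]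
    by (auto simp: quarter_arc_def power2_diff mult.commute)
  finally have "1\<^sup>2 \<le> (Re e - Im e)\<^sup>2" by simp
  then show ?thesis
    by (rule power2_le_imp_le) (use assms in \<open>auto simp: quarter_arc_def\<close>)
qed

text \<open>For \<open>|Im \<tau>| \<le> \<pi>/4\<close> both \<open>e\<close> and \<open>exp (-\<tau>)\<close> have nonnegative component in the
  direction \<open>1 - i\<close>; in the rest of the cone \<open>|Im \<tau>| \<le> K Re \<tau>\<close> the modulus of
  \<open>exp (-\<tau>)\<close> is at most \<open>exp (-\<pi>/(4K))\<close>.\<close>
definition sector_gap :: "real \<Rightarrow> real" where
  "sector_gap K = min (1 / 2) (1 - exp (- (pi / (4 * K))))"

lemma sector_gap_pos: "K > 0 \<Longrightarrow> sector_gap K > 0"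
  by (simp add: sector_gap_def)

lemma norm_quarter_arc_add_exp_ge:
  assumes e: "e \<in> quarter_arc" and K: "K > 0" and \<tau>: "\<bar>Im \<tau>\<bar> \<le> K * Re \<tau>"
  shows "norm (e + exp (- \<tau>)) \<ge> sector_gap K"
proof (cases "\<bar>Im \<tau>\<bar> \<le> pi / 4")
  case True
  have "cos (pi / 4) \<le> cos \<bar>Im \<tau>\<bar>"
    using True by (intro cos_monotone_0_pi_le) (auto intro: order_trans[OF _ pi_ge_zero])
  moreover have "sin (Im \<tau>) \<ge> sin (- (pi / 4))"
    using True by (intro sin_monotone_2pi_le) auto
  ultimately have "cos (Im \<tau>) + sin (Im \<tau>) \<ge> 0"
    by (simp add: cos_45 sin_45)
  then have "exp (- Re \<tau>) * (cos (Im \<tau>) + sin (Im \<tau>)) \<ge> 0" by simp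
  then have "Re (exp (- \<tau>)) - Im (exp (- \<tau>)) \<ge> 0"
    by (simp add: Re_exp Im_exp algebra_simps)
  with quarter_arc_sum_ge_one[OF e] have "Re (e + exp (- \<tau>)) - Im (e + exp (- \<tau>)) \<ge> 1" by simp
  \<comment> \<open>Each of the two components is bounded by the modulus, so the modulus is at least
    \<open>1 / 2\<close>, the first entry of \<open>sector_gap\<close>.\<close>
  with abs_Re_le_cmod[of "e + exp (- \<tau>)"] abs_Im_le_cmod[of "e + exp (- \<tau>)"]
  show ?thesis by (simp add: sector_gap_def)
next
  case False
  then have "pi / 4 \<le> K * Re \<tau>" using \<tau> by linarith
  then have "pi / (4 * K) \<le> Re \<tau>" using K by (simp add: field_simps)
  then have "exp (- Re \<tau>) \<le> exp (- (pi / (4 * K)))" by (simp del: times_divide_eq_right)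
  moreover have "norm (e + exp (- \<tau>)) \<ge> norm e - norm (exp (- \<tau>))"
    by (metis norm_diff_ineq)
  moreover have "norm e = 1" using e by (simp add: quarter_arc_def)
  moreover have "norm (exp (- \<tau>)) = exp (- Re \<tau>)" by simp
  ultimately have "1 - exp (- (pi / (4 * K))) \<le> norm (e + exp (- \<tau>))" by linarith
  then show ?thesis unfolding sector_gap_def by (rule min.coboundedI2)
qed

text \<open>The factor \<open>exp (- (n - 1) * t)\<close> of the integrand is absorbed into the
  Laplace variable \<open>z + n - 1\<close>; what remains is bounded by 1 for \<open>e\<close> on
  the quarter circle.\<close>

definition kern :: "complex \<Rightarrow> nat \<Rightarrow> real \<Rightarrow> complex" where
  "kern e n t = 1 / (e + exp (- of_real t)) ^ n"

lemma quarter_arc_add_exp_of_real_ge_one: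
  assumes "e \<in> quarter_arc"
  shows "norm (e + exp (- complex_of_real t)) \<ge> 1"
  using norm_quarter_arc_add_ge_one[OF assms, of "exp (- t)"] by (simp add: exp_of_real flip: of_real_minus)

lemma quarter_arc_add_exp_of_real_nonzero:
  "e \<in> quarter_arc \<Longrightarrow> e + exp (- complex_of_real t) \<noteq> 0"
  using quarter_arc_add_exp_of_real_ge_one[of e t] by auto

lemma norm_kern_le:
  assumes "e \<in> quarter_arc"
  shows "norm (kern e n t) \<le> 1"
  using one_le_power[OF quarter_arc_add_exp_of_real_ge_one[OF assms, of t], of n]
  by (simp add: kern_def norm_divide norm_power divide_le_eq_1)

lemma continuous_on_kern:
  "e \<in> quarter_arc \<Longrightarrow> continuous_on S (kern e n)"
  unfolding kern_def
  by (intro continuous_intros) (simp add: quarter_arc_add_exp_of_real_nonzero)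

lemma kern_has_vector_derivative:
  assumes e: "e \<in> quarter_arc"
  shows "(kern e n has_vector_derivative of_nat n * exp (- of_real t) * kern e (Suc n) t) (at t within S)"
proof -
  let ?w = "complex_of_real t"
  define X where "X = e + exp (- ?w)"
  have nz: "X \<noteq> 0" unfolding X_def by (rule quarter_arc_add_exp_of_real_nonzero[OF e])
  have d: "((\<lambda>w. e + exp (- w)) has_field_derivative - exp (- ?w)) (at ?w)"
    by (auto intro!: derivative_eq_intros)
  have "((\<lambda>w. inverse ((e + exp (- w)) ^ n)) has_field_derivative
      - (inverse (X ^ n) * (of_nat n * (- exp (- ?w) * X ^ (n - Suc 0))) * inverse (X ^ n))) (at ?w)"
    unfolding X_def
    by (rule DERIV_inverse'[OF DERIV_power[OF d]]) (use nz in \<open>simp add: X_def\<close>)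
  moreover have "- (inverse (X ^ n) * (of_nat n * (- exp (- ?w) * X ^ (n - Suc 0))) * inverse (X ^ n)) =
      of_nat n * exp (- ?w) * kern e (Suc n) t"
    using nz unfolding kern_def X_def[symmetric] by (cases n) (simp_all add: field_simps)
  ultimately have "((\<lambda>w. 1 / (e + exp (- w)) ^ n) has_field_derivative
      of_nat n * exp (- ?w) * kern e (Suc n) t) (at ?w)"
    by (simp add: inverse_eq_divide)
  then show ?thesis
    unfolding kern_def by (rule has_vector_derivative_real_field)
qed

text \<open>Integration by parts: the derivative of the kernel of order \<open>n\<close> is
  \<open>n * exp (- t)\<close> times the kernel of order \<open>n + 1\<close>, and the factor
  \<open>exp (- t)\<close> shifts the Laplace variable by 1.\<close>

lemma lap_kern_recurrence:
  assumes e: "e \<in> quarter_arc" and z: "Re z > 0"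
  shows "z * lap (kern e n) z = 1 / (1 + e) ^ n + of_nat n * lap (kern e (Suc n)) (z + 1)"
proof -
  let ?k' = "\<lambda>t. of_nat n * exp (- complex_of_real t) * kern e (Suc n) t"
  have cont: "continuous_on {0..} ?k'"
    by (intro continuous_intros continuous_on_kern e)
  have bound: "norm (?k' t) \<le> of_nat n" if "t \<ge> 0" for t
  proof -
    have "norm (exp (- complex_of_real t)) \<le> 1" using that by simp
    then have "norm (of_nat n * exp (- complex_of_real t)) \<le> of_nat n * 1"
      unfolding norm_mult by (intro mult_mono) auto
    then have "norm (?k' t) \<le> (of_nat n * 1) * 1"
      unfolding norm_mult[of _ "kern e (Suc n) t"] by (intro mult_mono norm_kern_le[OF e]) auto
    then show ?thesis by simp
  qed
  have "z * lap (kern e n) z = kern e n 0 + lap ?k' z"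
    by (rule lap_integration_by_parts[OF kern_has_vector_derivative[OF e] cont norm_kern_le[OF e] bound z])
  also have "lap ?k' z = integral {0..} (\<lambda>t. of_nat n * (kern e (Suc n) t * exp (- (of_real t * (z + 1)))))"
    unfolding lap_def by (simp add: algebra_simps exp_add exp_diff exp_minus divide_inverse)
  also have "\<dots> = of_nat n * lap (kern e (Suc n)) (z + 1)"
    unfolding lap_def by simp
  also have "kern e n 0 = 1 / (1 + e) ^ n" by (simp add: kern_def add.commute)
  finally show ?thesis .
qed

text \<open>For \<open>x\<close> in the first quadrant this is R_nk when \<open>e = ek k\<close> and
  \<open>z = 2 ^ k * yvar x\<close>, and minus R_n when \<open>e = 1\<close> and
  \<open>z = yvar x\<close>.\<close>

definition remainder_int :: "complex \<Rightarrow> nat \<Rightarrow> complex \<Rightarrow> complex" where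
  "remainder_int e n z =
     e * Gamma (of_nat n) / pochhammer z (n - 1) * lap (kern e n) (z + of_nat n - 1)"

text \<open>The summand of index \<open>n\<close> in the factorial expansion; for
  \<open>e = 1\<close> it enters the expansion with a minus sign.\<close>

definition expansion_term :: "complex \<Rightarrow> nat \<Rightarrow> complex \<Rightarrow> complex" where
  "expansion_term e n z = e * Gamma (of_nat n) / ((1 + e) ^ n * pochhammer z n)"

lemma pochhammer_nonzero:
  "z \<notin> \<real>\<^sub>\<le>\<^sub>0 \<Longrightarrow> pochhammer (z :: complex) n \<noteq> 0"
  by (auto simp: pochhammer_eq_0_iff)

text \<open>The kernel recurrence is used at \<open>z + n - 1\<close>, which is also the last factor
  of \<open>pochhammer z n\<close>. The bound on \<open>Re z\<close> says that this point lies in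
  the half-plane of convergence.\<close>

lemma remainder_int_recurrence:
  assumes e: "e \<in> quarter_arc" and n: "n \<ge> 1" and z: "z \<notin> \<real>\<^sub>\<le>\<^sub>0" "Re z + real n > 1"
  shows "remainder_int e n z = expansion_term e n z + remainder_int e (Suc n) z"
proof -
  obtain m where m: "n = Suc m" using n by (cases n) auto
  have nz: "z + of_nat m \<noteq> 0" "pochhammer z m \<noteq> 0"
    using pochhammer_nonzero[OF z(1), of "Suc m"] by (auto simp: pochhammer_Suc)
  have Gamma: "Gamma (of_nat (Suc n)) = of_nat n * (Gamma (of_nat n) :: complex)"
    using Gamma_fact[of m, where 'a = complex] Gamma_fact[of n, where 'a = complex] by (simp add: m)
  have lap: "(z + of_nat m) * lap (kern e n) (z + of_nat m) =
      1 / (1 + e) ^ n + of_nat n * lap (kern e (Suc n)) (z + of_nat (Suc n) - 1)"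
    using lap_kern_recurrence[OF e, of "z + of_nat m" n] z m by (simp add: add_ac)
  have "remainder_int e n z = e * Gamma (of_nat n) / pochhammer z n *
      ((z + of_nat m) * lap (kern e n) (z + of_nat m))"
    using nz by (simp add: remainder_int_def m pochhammer_Suc add_ac)
  also have "\<dots> = expansion_term e n z + remainder_int e (Suc n) z"
    unfolding lap remainder_int_def expansion_term_def Gamma
    by (simp only: distrib_left diff_Suc_1) (simp del: power_Suc of_nat_Suc add: mult_ac)
  finally show ?thesis .
qed

text \<open>\<open>N\<close> applications of the recurrence move the boundary of convergence from
  \<open>Re z = 1 - n\<close> to \<open>Re z = 1 - n - N\<close>.\<close>

definition continued_formula :: "complex \<Rightarrow> nat \<Rightarrow> nat \<Rightarrow> complex \<Rightarrow> complex" where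
  "continued_formula e n N z = remainder_int e (n + N) z + (\<Sum>m = n..<n + N. expansion_term e m z)"

text \<open>Any \<open>N\<close> with \<open>Re z + n + N > 1\<close> gives the same value; this choice has the property for
  every \<open>n \<ge> 1\<close>.\<close>
definition remainder :: "complex \<Rightarrow> nat \<Rightarrow> complex \<Rightarrow> complex" where
  "remainder e n z = continued_formula e n (nat \<lceil>1 - Re z\<rceil>) z"

lemma continued_formula_eq:
  assumes e: "e \<in> quarter_arc" and n: "n \<ge> 1" and z: "z \<notin> \<real>\<^sub>\<le>\<^sub>0"
    and N: "Re z + real (n + N) > 1" "N \<le> M"
  shows "continued_formula e n M z = continued_formula e n N z"
  using N(2)
proof (induction M rule: dec_induct)
  case (step M)
  have "remainder_int e (n + M) z = expansion_term e (n + M) z + remainder_int e (Suc (n + M)) z"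
    by (rule remainder_int_recurrence[OF e _ z]) (use n N step in auto)
  then have "continued_formula e n (Suc M) z = continued_formula e n M z"
    by (simp add: continued_formula_def)
  then show ?case using step.IH by (rule trans)
qed simp

lemma remainder_eq:
  assumes e: "e \<in> quarter_arc" and n: "n \<ge> 1" and z: "z \<notin> \<real>\<^sub>\<le>\<^sub>0" and N: "Re z + real (n + N) > 1"
  shows "remainder e n z = continued_formula e n N z"
proof -
  let ?M = "nat \<lceil>1 - Re z\<rceil>"
  have "1 - Re z \<le> real ?M" by linarith
  then have M: "Re z + real (n + ?M) > 1" using n by simp
  show ?thesis
    \<comment> \<open>Both cutoffs are compared with their maximum.\<close>
    unfolding remainder_def
    using continued_formula_eq[OF e n z N, of "max N ?M"] continued_formula_eq[OF e n z M, of "max N ?M"]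
    by simp
qed

section \<open>Holomorphy of the continued remainder on the cut plane\<close>

lemma holomorphic_lap_kern:
  assumes "e \<in> quarter_arc"
  shows "(\<lambda>z. lap (kern e n) (z + c)) holomorphic_on {z. Re (z + c) > 0}"
proof -
  have "lap (kern e n) holomorphic_on {z. Re z > 0}"
    by (rule holomorphic_lap[OF continuous_on_kern norm_kern_le]) (use assms in auto)
  then have "(lap (kern e n) \<circ> (\<lambda>z. z + c)) holomorphic_on {z. Re (z + c) > 0}"
    by (intro holomorphic_on_compose_gen[where t = "{z. Re z > 0}"] holomorphic_intros) auto
  then show ?thesis by (simp add: o_def)
qed

lemma one_add_quarter_arc_nonzero: "e \<in> quarter_arc \<Longrightarrow> 1 + e \<noteq> 0"
  using norm_quarter_arc_add_ge_one[of e 1] by (auto simp: add.commute)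

lemma holomorphic_continued_formula:
  assumes e: "e \<in> quarter_arc"
  shows "continued_formula e n N holomorphic_on {z. Re z + real (n + N) > 1} \<inter> - \<real>\<^sub>\<le>\<^sub>0"
proof -
  let ?U = "{z. Re z + real (n + N) > 1} \<inter> - \<real>\<^sub>\<le>\<^sub>0"
  have "(\<lambda>z. lap (kern e (n + N)) (z + (of_nat (n + N) - 1))) holomorphic_on ?U"
    by (rule holomorphic_on_subset[OF holomorphic_lap_kern[OF e]]) auto
  then have "(\<lambda>z. lap (kern e (n + N)) (z + of_nat (n + N) - 1)) holomorphic_on ?U"
    by (simp add: add_diff_eq)
  then show ?thesis
    unfolding continued_formula_def remainder_int_def expansion_term_def
    by (intro holomorphic_intros) (auto simp: pochhammer_nonzero one_add_quarter_arc_nonzero[OF e])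
qed

text \<open>The regions where one fixed \<open>N\<close> is admissible are open and exhaust the cut
  plane; on each of them the remainder is a single holomorphic formula.\<close>

lemma holomorphic_remainder:
  assumes e: "e \<in> quarter_arc" and n: "n \<ge> 1"
  shows "remainder e n holomorphic_on - \<real>\<^sub>\<le>\<^sub>0"
proof -
  let ?U = "\<lambda>N. {z. Re z + real (n + N) > 1} \<inter> - \<real>\<^sub>\<le>\<^sub>0"
  have "remainder e n holomorphic_on (\<Union>N. ?U N)"
  proof (rule holomorphic_on_UN_open)
    fix N
    show "remainder e n holomorphic_on ?U N"
      using holomorphic_continued_formula[OF e]
      by (rule holomorphic_transform) (use remainder_eq[OF e n] in auto)
    have "open {z. Re z > 1 - real (n + N)}" by (rule open_halfspace_Re_gt)
    moreover have "{z. Re z > 1 - real (n + N)} = {z. Re z + real (n + N) > 1}" by auto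
    ultimately show "open (?U N)" by (simp add: open_Int open_Compl)
  qed
  moreover have "(\<Union>N. ?U N) = - \<real>\<^sub>\<le>\<^sub>0"
  proof -
    have "\<exists>N. Re z + real (n + N) > 1" for z
    proof -
      obtain N where "1 - Re z < real N" using reals_Archimedean2 by blast
      then have "Re z + real (n + N) > 1" by simp
      then show ?thesis ..
    qed
    then show ?thesis by auto
  qed
  ultimately show ?thesis by simp
qed

text \<open>On \<open>p = - i * r\<close> the integrand becomes the Laplace integrand. The segment
  to \<open>-i\<close> is kept, and the horizontal ray from \<open>-i\<close> is turned downwards.
  The zeros of the denominator are real because \<open>norm e = 1\<close>, so none is
  crossed.\<close>

lemma integral_below_eq_lap:
  assumes e: "e \<in> quarter_arc" and n: "n \<ge> 1" and z: "Re z > 0" "Im z < 0"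
  shows "integral_below (\<lambda>p. exp (- \<i> * p * (z + of_nat n - 1)) / (e + exp (- \<i> * p)) ^ n) =
    - \<i> * lap (kern e n) (z + of_nat n - 1)"
proof -
  define w where "w = z + of_nat n - 1"
  define f where "f = (\<lambda>p. exp (- \<i> * p * w) / (e + exp (- \<i> * p)) ^ n)"
  define g where "g = (\<lambda>r. f (0 + of_real r * - \<i>))"
  define B where "B = 1 / (1 - exp (-1 :: real)) ^ n"
  have w: "Re w \<ge> Re z" "Im w = Im z" using n by (auto simp: w_def)
  have g_eq: "g = (\<lambda>r. kern e n r * exp (- (of_real r * w)))"
  proof
    fix r :: real
    have "- \<i> * (0 + of_real r * - \<i>) = - complex_of_real r" by (simp add: complex_eq_iff)
    then show "g r = kern e n r * exp (- (of_real r * w))"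
      unfolding g_def f_def kern_def by simp
  qed
  have gap: "norm (e + exp (- \<i> * p)) \<ge> 1 - exp (-1)" if "Im p \<le> -1" for p
  proof -
    have "norm (exp (- \<i> * p)) = exp (Im p)" by simp
    moreover have "exp (Im p) \<le> exp (-1)" using that by simp
    moreover have "norm (e + exp (- \<i> * p)) \<ge> norm e - norm (exp (- \<i> * p))"
      by (rule norm_diff_ineq)
    moreover have "norm e = 1" using e by (simp add: quarter_arc_def)
    ultimately show ?thesis by linarith
  qed
  have gap_pos: "0 < 1 - exp (-1 :: real)" by simp
  have nz: "e + exp (- \<i> * p) \<noteq> 0" if "Im p \<le> -1" for p
    using gap[OF that] gap_pos by (metis norm_zero not_le)
  have rot: "1 * integral {0..} (\<lambda>r. f (- \<i> + of_real r * 1)) =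
      - \<i> * integral {0..} (\<lambda>r. f (- \<i> + of_real r * - \<i>))"
  proof (rule ray_rotation)
    show "convex {p. Im p \<le> -1}" by (rule convex_halfspace_Im_le)
    show "f holomorphic_on {p. Im p \<le> -1}"
      unfolding f_def by (intro holomorphic_intros) (use nz in auto)
    show "min (Re z) (- Im z) > 0" using z by simp
    fix s t :: real assume st: "s \<ge> 0" "t \<ge> 0"
    let ?p = "- \<i> + of_real s * 1 + of_real t * - \<i>"
    have Im_p: "Im ?p \<le> -1" using st by simp
    then show "?p \<in> {p. Im p \<le> -1}" by simp
    \<comment> \<open>Decay in the horizontal direction comes from \<open>Im z < 0\<close>, in the
      downward direction from \<open>Re z > 0\<close>; the smaller of the two rates serves for
      both.\<close>
    have "Re (- \<i> * ?p * w) = s * Im z - (1 + t) * Re w"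
      using w by (simp add: algebra_simps)
    also have "\<dots> \<le> s * Im z - (1 + t) * Re z"
      using w st by (intro diff_left_mono mult_left_mono) auto
    also have "\<dots> \<le> s * Im z - t * Re z" using z by (simp add: algebra_simps)
    also have "\<dots> \<le> - min (Re z) (- Im z) * (s + t)"
    proof -
      have "s * min (Re z) (- Im z) \<le> s * (- Im z)" "t * min (Re z) (- Im z) \<le> t * Re z"
        by (rule mult_left_mono; simp add: st)+
      then show ?thesis by (simp add: algebra_simps)
    qed
    finally have "norm (exp (- \<i> * ?p * w)) \<le> exp (- min (Re z) (- Im z) * (s + t))"
      unfolding norm_exp_eq_Re by simp
    moreover have "(1 - exp (-1)) ^ n \<le> norm (e + exp (- \<i> * ?p)) ^ n"
      using gap[OF Im_p] by (intro power_mono) auto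
    ultimately have "norm (f ?p) \<le> exp (- min (Re z) (- Im z) * (s + t)) / (1 - exp (-1)) ^ n"
      unfolding f_def norm_divide norm_power using gap_pos by (intro frac_le) auto
    then show "norm (f ?p) \<le> B * exp (- min (Re z) (- Im z) * (s + t))"
      by (simp add: B_def)
  qed
  have contg: "continuous_on {0..} g"
    unfolding g_eq by (intro continuous_on_lap_integrand continuous_on_kern e)
  \<comment> \<open>Parameter 1 on the downward ray is the corner \<open>-i\<close> of the
    path.\<close>
  have "integral {0..} g = integral {0..1} g + integral {0..} (\<lambda>t. g (1 + t))"
  proof (rule exp_decay_integral_shift[OF contg])
    show "Re z > 0" by (rule z)
    show "norm (g t) \<le> 1 * exp (- Re z * t)" if "t \<ge> 0" for t
      unfolding g_eq by (rule norm_lap_integrand_le[OF norm_kern_le[OF e] that w(1)])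
  qed
  moreover have "contour_integral (linepath 0 (- \<i>)) f = - \<i> * integral {0..1} g"
  proof -
    have "continuous_on (closed_segment 0 (- \<i>)) f"
      unfolding f_def
    proof (intro continuous_intros)
      show "\<forall>p\<in>closed_segment 0 (- \<i>). (e + exp (- \<i> * p)) ^ n \<noteq> 0"
      proof
        fix p assume "p \<in> closed_segment 0 (- \<i>)"
        then obtain u where "p = u *\<^sub>R - \<i>" by (auto simp: in_segment)
        then have "- \<i> * p = - of_real u" by (simp add: complex_eq_iff)
        then show "(e + exp (- \<i> * p)) ^ n \<noteq> 0"
          using quarter_arc_add_exp_of_real_nonzero[OF e] by simp
      qed
    qed
    then have "f contour_integrable_on linepath 0 (0 + of_real 1 * - \<i>)"
      by (simp add: contour_integrable_continuous_linepath)
    from integral_linepath_ray[OF contg[unfolded g_def] _ this] show ?thesis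
      by (simp add: g_def)
  qed
  moreover have "integral {0..} (\<lambda>t. f (of_real t - \<i>)) = - \<i> * integral {0..} (\<lambda>t. g (1 + t))"
    using rot by (simp add: g_def algebra_simps)
  ultimately have "integral_below f = - \<i> * integral {0..} g"
    unfolding integral_below_def by (simp add: algebra_simps)
  then show ?thesis by (simp add: f_def w_def[symmetric] g_eq lap_def)
qed

lemma quadrant_integral_eq_remainder_int:
  assumes "e \<in> quarter_arc" "n \<ge> 1" "Re z > 0" "Im z < 0"
  shows "\<i> * e * Gamma (of_nat n) / pochhammer z (n - 1) *
      integral_below (\<lambda>p. exp (- \<i> * p * (z + of_nat n - 1)) / (e + exp (- \<i> * p)) ^ n) =
    remainder_int e n z"
  unfolding integral_below_eq_lap[OF assms] remainder_int_def by (simp add: field_simps)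

lemma remainder_eq_remainder_int:
  assumes "e \<in> quarter_arc" "n \<ge> 1" "z \<notin> \<real>\<^sub>\<le>\<^sub>0" "Re z + real n > 1"
  shows "remainder e n z = remainder_int e n z"
  using remainder_eq[OF assms(1-3), of 0] assms(4) by (simp add: continued_formula_def)

section \<open>Rotated rays\<close>

text \<open>The integrand at \<open>\<tau> = r * a\<close>. Unlike in \<open>kern\<close>, the
  factor with exponent \<open>n - 1\<close> stays in the kernel, so the Laplace variable is exactly
  \<open>a * z\<close> and convergence needs only \<open>Re (a * z) > 0\<close>.\<close>

definition rot_kern :: "complex \<Rightarrow> complex \<Rightarrow> nat \<Rightarrow> real \<Rightarrow> complex" where
  "rot_kern a e n r =
     exp (- (of_real r * a * (of_nat n - 1))) / (e + exp (- (of_real r * a))) ^ n"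

lemma norm_sector_integrand_le:
  assumes e: "e \<in> quarter_arc" and n: "n \<ge> 1" and K: "K > 0" and \<tau>: "\<bar>Im \<tau>\<bar> \<le> K * Re \<tau>"
  shows "norm (exp (- (\<tau> * (of_nat n - 1))) / (e + exp (- \<tau>)) ^ n) \<le> 1 / sector_gap K ^ n"
proof -
  have "Re \<tau> \<ge> 0" using \<tau> K by (metis abs_ge_zero order_trans zero_le_mult_iff not_le)
  then have "norm (exp (- (\<tau> * (of_nat n - 1)))) \<le> 1"
    using n by simp
  moreover have "sector_gap K ^ n \<le> norm (e + exp (- \<tau>)) ^ n"
    using sector_gap_pos[OF K] norm_quarter_arc_add_exp_ge[OF e K \<tau>] by (intro power_mono) auto
  ultimately show ?thesis
    unfolding norm_divide norm_power using sector_gap_pos[OF K] by (intro frac_le) auto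
qed

lemma sector_add_exp_nonzero:
  assumes "e \<in> quarter_arc" "K > 0" "\<bar>Im \<tau>\<bar> \<le> K * Re \<tau>"
  shows "e + exp (- \<tau>) \<noteq> 0"
  using norm_quarter_arc_add_exp_ge[OF assms] sector_gap_pos[OF assms(2)] by (metis norm_zero not_le)

context
  fixes a :: complex and K :: real
  assumes a: "Re a > 0" "\<bar>Im a\<bar> \<le> K * Re a" and K: "K > 0"
begin

lemma ray_in_sector:
  assumes "r \<ge> 0"
  shows "\<bar>Im (of_real r * a)\<bar> \<le> K * Re (of_real r * a)"
  using mult_left_mono[OF a(2) assms] assms by (simp add: abs_mult mult_ac)

lemma norm_rot_kern_le:
  assumes "e \<in> quarter_arc" "n \<ge> 1" "r \<ge> 0"
  shows "norm (rot_kern a e n r) \<le> 1 / sector_gap K ^ n"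
  unfolding rot_kern_def by (rule norm_sector_integrand_le[OF assms(1,2) K ray_in_sector[OF assms(3)]])

lemma continuous_on_rot_kern:
  assumes "e \<in> quarter_arc"
  shows "continuous_on {0..} (rot_kern a e n)"
  unfolding rot_kern_def
  by (intro continuous_intros) (use sector_add_exp_nonzero[OF assms K ray_in_sector] in auto)

text \<open>The sector spanned by the directions \<open>1\<close> and \<open>a\<close> lies in the
  cone of slope \<open>K\<close>, where the denominator has no zeros. The two positivity conditions
  give decay along both rays, so one can be rotated into the other.\<close>

lemma lap_kern_rotate:
  assumes e: "e \<in> quarter_arc" and n: "n \<ge> 1" and z: "Re z > 0" "Re (a * z) > 0"
  shows "lap (kern e n) (z + of_nat n - 1) = a * lap (rot_kern a e n) (a * z)"
proof -
  let ?S = "{\<tau>. \<bar>Im \<tau>\<bar> \<le> K * Re \<tau>}"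
  define f where "f = (\<lambda>\<tau>. exp (- (\<tau> * (of_nat n - 1))) / (e + exp (- \<tau>)) ^ n * exp (- (\<tau> * z)))"
  define \<kappa> where "\<kappa> = min (Re z) (Re (a * z))"
  have "1 * integral {0..} (\<lambda>r. f (0 + of_real r * 1)) = a * integral {0..} (\<lambda>r. f (0 + of_real r * a))"
  proof (rule ray_rotation)
    show "convex ?S"
    proof (rule convexI)
      fix x y :: complex and u v :: real
      assume xy: "x \<in> ?S" "y \<in> ?S" and uv: "u \<ge> 0" "v \<ge> 0"
      have "\<bar>u * Im x + v * Im y\<bar> \<le> u * \<bar>Im x\<bar> + v * \<bar>Im y\<bar>"
        using uv by (metis abs_mult abs_of_nonneg abs_triangle_ineq)
      also have "\<dots> \<le> u * (K * Re x) + v * (K * Re y)"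
        using xy uv by (intro add_mono mult_left_mono) auto
      finally show "u *\<^sub>R x + v *\<^sub>R y \<in> ?S" by (simp add: algebra_simps)
    qed
    show "f holomorphic_on ?S"
      unfolding f_def by (intro holomorphic_intros) (use sector_add_exp_nonzero[OF e K] in auto)
    show "\<kappa> > 0" using z by (simp add: \<kappa>_def)
    fix s t :: real assume st: "s \<ge> 0" "t \<ge> 0"
    let ?\<tau> = "0 + of_real s * 1 + of_real t * a"
    have "\<bar>Im ?\<tau>\<bar> \<le> K * Re (of_real t * a)" using ray_in_sector[OF st(2)] by simp
    also have "\<dots> \<le> K * Re ?\<tau>" using st K by (intro mult_left_mono) auto
    finally have \<tau>: "\<bar>Im ?\<tau>\<bar> \<le> K * Re ?\<tau>" .
    then show "?\<tau> \<in> ?S" by simp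
    have "\<kappa> * (s + t) = s * \<kappa> + t * \<kappa>" by (simp add: algebra_simps)
    also have "\<dots> \<le> s * Re z + t * Re (a * z)"
      using st by (intro add_mono mult_left_mono) (auto simp: \<kappa>_def simp del: times_complex.sel)
    also have "\<dots> = Re (?\<tau> * z)" by (simp add: algebra_simps)
    finally have "norm (exp (- (?\<tau> * z))) \<le> exp (- \<kappa> * (s + t))"
      unfolding norm_exp_eq_Re by simp
    then show "norm (f ?\<tau>) \<le> 1 / sector_gap K ^ n * exp (- \<kappa> * (s + t))"
      unfolding f_def norm_mult[of _ "exp (- (?\<tau> * z))"]
      using sector_gap_pos[OF K]
      by (intro mult_mono norm_sector_integrand_le[OF e n K \<tau>]) auto
  qed
  moreover have "f (of_real r) = kern e n r * exp (- (of_real r * (z + of_nat n - 1)))" for r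
    by (simp add: f_def kern_def flip: exp_add) (simp add: algebra_simps)
  moreover have "f (of_real r * a) = rot_kern a e n r * exp (- (of_real r * (a * z)))" for r
    by (simp add: f_def rot_kern_def mult_ac)
  ultimately show ?thesis by (simp add: lap_def)
qed

text \<open>The half-plane \<open>Re (a * z) > 0\<close> avoids the cut because
  \<open>Re a > 0\<close>. Both sides are holomorphic there and agree where also
  \<open>Re z > 0\<close>, hence everywhere by the identity theorem.\<close>

lemma remainder_eq_rotated:
  assumes e: "e \<in> quarter_arc" and n: "n \<ge> 1" and z: "Re (a * z) > 0"
  shows "remainder e n z = e * Gamma (of_nat n) / pochhammer z (n - 1) *
    (a * lap (rot_kern a e n) (a * z))"
proof -
  let ?H = "{z. Re (a * z) > 0}" and ?Q = "{z. Re (a * z) > 0} \<inter> {z. Re z > 0}"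
  have H_inner: "?H = {z. inner (cnj a) z > 0}" by (simp add: inner_complex_def)
  have not_neg: "w \<notin> \<real>\<^sub>\<le>\<^sub>0" if "Re (a * w) > 0" for w
    using that a by (auto elim!: nonpos_Reals_cases simp: zero_less_mult_iff)
  show ?thesis
  proof (rule analytic_continuation_open[of ?Q ?H "remainder e n"
        "\<lambda>z. e * Gamma (of_nat n) / pochhammer z (n - 1) * (a * lap (rot_kern a e n) (a * z))"])
    show "open ?H" unfolding H_inner by (rule open_halfspace_gt)
    then show "open ?Q" by (intro open_Int open_halfspace_Re_gt)
    have "1 \<in> ?Q" using a by simp
    then show "?Q \<noteq> {}" by blast
    show "connected ?H" unfolding H_inner by (intro convex_connected convex_halfspace_gt)
    show "remainder e n holomorphic_on ?H"
      by (rule holomorphic_on_subset[OF holomorphic_remainder[OF e n]]) (use not_neg in auto)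
    have "lap (rot_kern a e n) holomorphic_on {z. Re z > 0}"
      by (rule holomorphic_lap[OF continuous_on_rot_kern norm_rot_kern_le]) (use e n in auto)
    then have "(lap (rot_kern a e n) \<circ> (\<lambda>z. a * z)) holomorphic_on ?H"
      by (intro holomorphic_on_compose_gen[where t = "{z. Re z > 0}"] holomorphic_intros) auto
    then have "(\<lambda>z. lap (rot_kern a e n) (a * z)) holomorphic_on ?H" by (simp add: o_def)
    then show "(\<lambda>z. e * Gamma (of_nat n) / pochhammer z (n - 1) *
        (a * lap (rot_kern a e n) (a * z))) holomorphic_on ?H"
      by (intro holomorphic_intros) (use not_neg pochhammer_nonzero in auto)
    fix w assume "w \<in> ?Q"
    then have w: "Re w > 0" "Re (a * w) > 0" by auto
    have "remainder e n w = remainder_int e n w"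
      by (rule remainder_eq_remainder_int[OF e n not_neg[OF w(2)]]) (use w n in simp)
    then show "remainder e n w = e * Gamma (of_nat n) / pochhammer w (n - 1) *
        (a * lap (rot_kern a e n) (a * w))"
      unfolding remainder_int_def lap_kern_rotate[OF e n w] .
  qed (use z in auto)
qed

end

text \<open>Every factor \<open>z + j\<close> with \<open>j < m\<close> has modulus at least
  \<open>norm z - m\<close>, hence at least half of \<open>norm z\<close>.\<close>

lemma norm_pochhammer_ge:
  fixes z :: complex
  assumes "norm z \<ge> 2 * real m"
  shows "norm (pochhammer z m) \<ge> (norm z / 2) ^ m"
  using assms
proof (induction m)
  case (Suc m)
  have "norm z / 2 \<le> norm (z + of_nat m)"
    using norm_diff_ineq[of z "of_nat m"] Suc.prems by simp
  then show ?case
    using Suc unfolding pochhammer_Suc norm_mult power_Suc2 by (intro mult_mono) auto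
qed simp

text \<open>A turn by \<open>\<theta>\<close> or \<open>- \<theta>\<close> gives
  \<open>Re (a * z) \<ge> norm z * cos \<theta>\<close>. The Laplace integral then supplies one
  power of \<open>1 / norm z\<close> and the Pochhammer symbol the other \<open>n - 1\<close>. The
  constant depends on \<open>n\<close> and \<open>\<delta>\<close> only, not on
  \<open>e\<close>.\<close>

lemma remainder_sector_bound:
  assumes n: "n \<ge> 1" and \<delta>: "\<delta> > 0"
  obtains C where "\<And>e z. \<lbrakk>e \<in> quarter_arc; z \<noteq> 0; \<bar>Arg z\<bar> \<le> pi - \<delta>; norm z \<ge> 2 * real n\<rbrakk> \<Longrightarrow>
    norm (remainder e n z) \<le> C / norm z ^ n"
proof -
  \<comment> \<open>Half the largest argument to be covered, so less than a right angle. Capping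
    \<open>\<delta>\<close> at 1 keeps \<open>\<theta>\<close> positive for every
    \<open>\<delta> > 0\<close> and only enlarges the sector.\<close>
  define \<theta> where "\<theta> = (pi - min \<delta> 1) / 2"
  have \<theta>: "0 < \<theta>" "\<theta> < pi / 2" using \<delta> pi_gt3 by (auto simp: \<theta>_def)
  have cos: "cos \<theta> > 0" using \<theta> by (intro cos_gt_zero) auto
  have tan: "tan \<theta> > 0" using \<theta> by (intro tan_gt_zero) auto
  have sin: "sin \<theta> > 0" using \<theta> by (intro sin_gt_zero) auto
  define M where "M = 1 / sector_gap (tan \<theta>) ^ n"
  define G where "G = norm (Gamma (of_nat n) :: complex)"
  have M: "M \<ge> 0" using sector_gap_pos[OF tan] by (simp add: M_def)
  show ?thesis
  proof (rule that)
    fix e z :: complex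
    assume e: "e \<in> quarter_arc" and z: "z \<noteq> 0" "\<bar>Arg z\<bar> \<le> pi - \<delta>" "norm z \<ge> 2 * real n"
    \<comment> \<open>Turning by \<open>\<theta>\<close> towards the real axis maps the half sector \<open>0 \<le> Arg z \<le> 2\<theta>\<close>
      onto \<open>|Arg| \<le> \<theta>\<close>.\<close>
    define \<phi> where "\<phi> = (if Arg z \<ge> 0 then - \<theta> else \<theta>)"
    define a where "a = cis \<phi>"
    have a: "Re a > 0" "\<bar>Im a\<bar> \<le> tan \<theta> * Re a"
      using cos sin by (auto simp: a_def \<phi>_def tan_def)
    have "\<bar>Arg z\<bar> \<le> 2 * \<theta>" using z(2) by (simp add: \<theta>_def)
    then have "\<bar>Arg z + \<phi>\<bar> \<le> \<theta>" by (cases "Arg z \<ge> 0") (simp_all add: \<phi>_def)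
    then have "cos \<theta> \<le> cos \<bar>Arg z + \<phi>\<bar>" using \<theta> by (intro cos_monotone_0_pi_le) auto
    moreover have "a * z = of_real (norm z) * cis (Arg z + \<phi>)"
    proof -
      have "z = of_real (norm z) * cis (Arg z)"
        using rcis_cmod_Arg[of z] by (simp add: rcis_def)
      then show ?thesis unfolding a_def by (metis cis_mult mult.assoc mult.commute)
    qed
    ultimately have Re_az: "Re (a * z) \<ge> norm z * cos \<theta>"
      by (simp add: mult_left_mono)
    moreover have z_cos: "norm z * cos \<theta> > 0" using z cos by simp
    ultimately have az: "Re (a * z) > 0" by linarith
    have "norm (lap (rot_kern a e n) (a * z)) \<le> M / Re (a * z)"
      unfolding M_def
      by (rule norm_lap_le[OF continuous_on_rot_kern[OF a tan e] norm_rot_kern_le[OF a tan e n] az])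
    also have "\<dots> \<le> M / (norm z * cos \<theta>)"
      by (rule divide_left_mono[OF Re_az M mult_pos_pos[OF az z_cos]])
    finally have lap: "norm (lap (rot_kern a e n) (a * z)) \<le> M / (norm z * cos \<theta>)" .
    have poch: "(norm z / 2) ^ (n - 1) \<le> norm (pochhammer z (n - 1))"
      using z(3) n by (intro norm_pochhammer_ge) auto
    have "norm (remainder e n z) =
        G / norm (pochhammer z (n - 1)) * norm (lap (rot_kern a e n) (a * z))"
      using e unfolding remainder_eq_rotated[OF a tan e n az]
      by (simp add: norm_mult norm_divide G_def a_def quarter_arc_def)
    also have "\<dots> \<le> G / (norm z / 2) ^ (n - 1) * (M / (norm z * cos \<theta>))"
    proof (rule mult_mono[OF _ lap])
      have pos: "(norm z / 2) ^ (n - 1) > 0" using z(1) by simp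
      show "G / norm (pochhammer z (n - 1)) \<le> G / (norm z / 2) ^ (n - 1)"
        by (rule divide_left_mono[OF poch _ mult_pos_pos[OF less_le_trans[OF pos poch] pos]])
          (simp add: G_def)
      show "0 \<le> G / (norm z / 2) ^ (n - 1)" by (simp add: G_def)
    qed simp
    also have "\<dots> = (G * 2 ^ (n - 1) * M / cos \<theta>) / (norm z ^ (n - 1) * norm z)"
      using z(1) cos by (simp add: power_divide field_simps)
    also have "norm z ^ (n - 1) * norm z = norm z ^ n"
      using n by (metis Suc_diff_1 less_eq_Suc_le One_nat_def power_Suc2)
    finally show "norm (remainder e n z) \<le> (G * 2 ^ (n - 1) * M / cos \<theta>) / norm z ^ n" .
  qed
qed

section \<open>Large order\<close>

text \<open>For \<open>s = exp (- t)\<close> the squares of \<open>norm (e + s)\<close> and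
  \<open>norm (1 + e) * sqrt s\<close> differ by exactly \<open>(1 - s)^2\<close>.\<close>

lemma norm_kern_le_exp:
  assumes e: "e \<in> quarter_arc"
  shows "norm (kern e n t) \<le> 1 / norm (1 + e) ^ n * exp (real n * t / 2)"
proof -
  define s where "s = exp (- t)"
  have "norm e = 1" using e by (simp add: quarter_arc_def)
  then have sq: "(norm (e + of_real r))\<^sup>2 = 1 + 2 * r * Re e + r\<^sup>2" for r
    using cmod_power2[of e] unfolding cmod_power2[of "e + of_real r"]
    by (simp add: power2_eq_square algebra_simps)
  have "(norm (1 + e) * exp (- (t / 2)))\<^sup>2 = (norm (1 + e))\<^sup>2 * s"
    by (simp add: power_mult_distrib s_def flip: exp_double)
  also have "(norm (1 + e))\<^sup>2 = 2 + 2 * Re e"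
    using sq[of 1] by (simp add: add.commute)
  also have "(2 + 2 * Re e) * s \<le> 1 + 2 * s * Re e + s\<^sup>2"
    using zero_le_power2[of "1 - s"] by (simp add: power2_eq_square algebra_simps)
  also have "\<dots> = (norm (e + exp (- of_real t)))\<^sup>2"
    using sq[of s] by (simp add: s_def exp_of_real flip: of_real_minus)
  finally have "norm (1 + e) * exp (- (t / 2)) \<le> norm (e + exp (- of_real t))"
    by (rule power2_le_imp_le) simp
  then have "(norm (1 + e) * exp (- (t / 2))) ^ n \<le> norm (e + exp (- of_real t)) ^ n"
    by (intro power_mono) auto
  then have "norm (kern e n t) \<le> 1 / (norm (1 + e) * exp (- (t / 2))) ^ n"
    using one_add_quarter_arc_nonzero[OF e]
    by (simp add: kern_def norm_divide norm_power frac_le)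
  also have "\<dots> = 1 / norm (1 + e) ^ n * exp (real n * t / 2)"
    by (simp add: power_mult_distrib exp_minus field_simps flip: exp_of_nat_mult)
  finally show ?thesis .
qed

text \<open>The kernel may be bounded by a function growing like \<open>exp (n * t / 2)\<close>,
  because the Laplace factor absorbs this growth as soon as \<open>Re w\<close> exceeds
  \<open>n / 2\<close>.\<close>

lemma norm_lap_kern_le:
  assumes e: "e \<in> quarter_arc" and w: "Re w > real n / 2"
  shows "norm (lap (kern e n) w) \<le> 1 / norm (1 + e) ^ n / (Re w - real n / 2)"
proof -
  have "norm (kern e n t * exp (- (of_real t * w))) \<le>
      1 / norm (1 + e) ^ n * exp (- (Re w - real n / 2) * t)" for t
  proof -
    have "norm (kern e n t * exp (- (of_real t * w))) = norm (kern e n t) * exp (- (t * Re w))"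
      by (simp add: norm_mult)
    also have "\<dots> \<le> 1 / norm (1 + e) ^ n * exp (real n * t / 2) * exp (- (t * Re w))"
      by (intro mult_right_mono norm_kern_le_exp[OF e]) auto
    also have "\<dots> = 1 / norm (1 + e) ^ n * exp (- (Re w - real n / 2) * t)"
      by (simp add: algebra_simps flip: exp_add)
    finally show ?thesis .
  qed
  then have "norm (lap (kern e n) w) \<le> 1 / norm (1 + e) ^ n * (exp (- (Re w - real n / 2) * 0) / (Re w - real n / 2))"
    unfolding lap_def
    by (intro norm_exp_decay_integral_le continuous_on_lap_integrand continuous_on_kern e) (use w in auto)
  then show ?thesis by simp
qed

text \<open>Euler's sequence \<open>Gamma_series' z\<close> converges, so it is bounded. It contains
  \<open>pochhammer z n\<close> in place of \<open>pochhammer z (n - 1)\<close>; the extra factor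
  \<open>z + n - 1\<close> accounts for \<open>norm z + n\<close>.\<close>

lemma Gamma_over_pochhammer_bound:
  fixes z :: complex
  obtains M where "M > 0" "\<And>n. n \<ge> 1 \<Longrightarrow> z \<notin> \<real>\<^sub>\<le>\<^sub>0 \<Longrightarrow>
    norm (Gamma (of_nat n) / pochhammer z (n - 1)) \<le> M * real n powr (- Re z) * (norm z + real n)"
proof -
  have "Bseq (Gamma_series' z)"
    using Gamma_series'_LIMSEQ by (intro convergent_imp_Bseq convergentI)
  then obtain M where M: "M > 0" "\<And>n. norm (Gamma_series' z n) \<le> M"
    by (auto elim: BseqE)
  show ?thesis
  proof (rule that[OF M(1)])
    fix n :: nat assume n: "n \<ge> 1" and z: "z \<notin> \<real>\<^sub>\<le>\<^sub>0"
    obtain m where m: "n = Suc m" using n by (cases n) auto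
    have nz: "z + of_nat m \<noteq> 0" "pochhammer z m \<noteq> 0"
      using pochhammer_nonzero[OF z, of "Suc m"] by (auto simp: pochhammer_Suc)
    let ?E = "exp (z * of_real (ln (of_nat n)))"
    have eq: "Gamma (of_nat n) / pochhammer z (n - 1) = Gamma_series' z n / ?E * (z + of_nat m)"
      using nz Gamma_fact[of m, where 'a = complex]
      by (simp add: m Gamma_series'_def pochhammer_Suc)
    have norm_E: "norm ?E = real n powr Re z"
      using n by (simp add: powr_def)
    have "norm (Gamma (of_nat n) / pochhammer z (n - 1)) =
        norm (Gamma_series' z n) * real n powr (- Re z) * norm (z + of_nat m)"
      unfolding eq norm_mult norm_divide[of _ ?E] norm_E by (simp add: powr_minus divide_inverse)
    also have "\<dots> \<le> M * real n powr (- Re z) * (norm z + real n)"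
      using M norm_triangle_ineq[of z "of_nat m"] by (intro mult_mono) (auto simp: m)
    finally show "norm (Gamma (of_nat n) / pochhammer z (n - 1)) \<le>
        M * real n powr (- Re z) * (norm z + real n)" .
  qed
qed

text \<open>The surplus factor of order \<open>n\<close> in the Gamma quotient cancels against the
  decay of order \<open>1 / n\<close> of the Laplace integral.\<close>

lemma remainder_large_n:
  assumes e: "e \<in> quarter_arc" and z: "z \<notin> \<real>\<^sub>\<le>\<^sub>0"
  shows "(\<lambda>n. remainder e n z) \<in>
    O(\<lambda>n. complex_of_real ((1 / norm (1 + e)) ^ n * real n powr (- Re z)))"
proof -
  obtain M where M: "M > 0" "\<And>n. n \<ge> 1 \<Longrightarrow> z \<notin> \<real>\<^sub>\<le>\<^sub>0 \<Longrightarrow>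
      norm (Gamma (of_nat n) / pochhammer z (n - 1)) \<le> M * real n powr (- Re z) * (norm z + real n)"
    using Gamma_over_pochhammer_bound by blast
  show ?thesis
  proof (rule bigoI)
    \<comment> \<open>From here on \<open>Re z + n - 1\<close> exceeds \<open>n / 2\<close> by at
      least \<open>n / 4\<close>. The constant 8 below is 4 from this margin times 2 from
      \<open>norm z + n \<le> 2 * n\<close>.\<close>
    have "eventually (\<lambda>n. real n \<ge> 4 * norm z + 4) sequentially"
      by real_asymp
    then show "\<forall>\<^sub>F n in sequentially. norm (remainder e n z) \<le>
        8 * M * norm (complex_of_real ((1 / norm (1 + e)) ^ n * real n powr (- Re z)))"
    proof eventually_elim
      case (elim n)
      have Re_z: "- norm z \<le> Re z" using abs_Re_le_cmod[of z] by linarith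
      have n: "norm z \<le> real n" using elim norm_ge_zero[of z] by linarith
      have "real n \<ge> 1" using elim norm_ge_zero[of z] by linarith
      with n have n: "n \<ge> 1" "real n > 0" "norm z \<le> real n" by simp_all
      let ?w = "z + of_nat n - 1" and ?c = "1 / norm (1 + e) ^ n"
      have w: "Re ?w - real n / 2 \<ge> real n / 4" using elim Re_z by simp
      have "norm (lap (kern e n) ?w) \<le> ?c / (Re ?w - real n / 2)"
        by (rule norm_lap_kern_le[OF e]) (use w n in linarith)
      also have "\<dots> \<le> ?c / (real n / 4)"
        using w n by (intro divide_left_mono mult_pos_pos) (auto intro: less_le_trans[OF _ w])
      finally have lap: "norm (lap (kern e n) ?w) \<le> ?c / (real n / 4)" .
      \<comment> \<open>The order is already so large that the integral itself converges and no
        expansion terms have to be added.\<close>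
      have "remainder e n z = remainder_int e n z"
        by (rule remainder_eq_remainder_int[OF e n(1) z]) (use elim Re_z norm_ge_zero[of z] in linarith)
      then have "norm (remainder e n z) =
          norm (Gamma (of_nat n) / pochhammer z (n - 1)) * norm (lap (kern e n) ?w)"
        using e by (simp add: remainder_int_def norm_mult norm_divide quarter_arc_def)
      also have "\<dots> \<le> M * real n powr (- Re z) * (norm z + real n) * (?c / (real n / 4))"
        using M by (intro mult_mono M(2)[OF n(1) z] lap) auto
      also have "\<dots> \<le> M * real n powr (- Re z) * (real n + real n) * (?c / (real n / 4))"
        using M n by (intro mult_right_mono mult_left_mono add_right_mono) auto
      also have "\<dots> = 8 * M * (?c * real n powr (- Re z))"
        using n(2) by (simp add: field_simps)
      also have "?c * real n powr (- Re z) =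
          norm (complex_of_real ((1 / norm (1 + e)) ^ n * real n powr (- Re z)))"
        unfolding norm_of_real by (simp add: power_one_over)
      finally show ?case .
    qed
  qed
qed

section \<open>The remainders of the expansion\<close>

lemma slit_plane_iff: "x \<in> slit_plane \<longleftrightarrow> yvar x \<notin> \<real>\<^sub>\<le>\<^sub>0"
proof -
  have "yvar x \<in> \<real>\<^sub>\<le>\<^sub>0 \<longleftrightarrow> (\<exists>t\<ge>0. x = - \<i> * of_real t)"
  proof
    assume "yvar x \<in> \<real>\<^sub>\<le>\<^sub>0"
    then obtain r where r: "yvar x = of_real r" "r \<le> 0" by (auto elim: nonpos_Reals_cases)
    have "x = \<i> * of_real pi * yvar x" by (simp add: yvar_def)
    also have "\<dots> = - \<i> * of_real (- (pi * r))" unfolding r by simp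
    finally show "\<exists>t\<ge>0. x = - \<i> * of_real t"
      using r by (intro exI[of _ "- (pi * r)"]) (auto intro: mult_nonneg_nonpos)
  next
    assume "\<exists>t\<ge>0. x = - \<i> * of_real t"
    then obtain t where t: "t \<ge> 0" "x = - \<i> * of_real t" by blast
    have "yvar x = of_real (- (t / pi))" unfolding yvar_def t by simp
    then show "yvar x \<in> \<real>\<^sub>\<le>\<^sub>0" using t by (simp only: nonpos_Reals_of_real_iff) simp
  qed
  then show ?thesis unfolding slit_plane_def by auto
qed

lemma slit_plane_eq_image: "slit_plane = (\<lambda>y. \<i> * of_real pi * y) ` (- \<real>\<^sub>\<le>\<^sub>0)"
proof (intro set_eqI iffI)
  fix x assume "x \<in> slit_plane"
  moreover have "x = \<i> * of_real pi * yvar x" by (simp add: yvar_def)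
  ultimately show "x \<in> (\<lambda>y. \<i> * of_real pi * y) ` (- \<real>\<^sub>\<le>\<^sub>0)"
    unfolding slit_plane_iff by blast
next
  fix x assume "x \<in> (\<lambda>y. \<i> * of_real pi * y) ` (- \<real>\<^sub>\<le>\<^sub>0)"
  then obtain y where "x = \<i> * of_real pi * y" "y \<notin> \<real>\<^sub>\<le>\<^sub>0" by blast
  moreover from this have "yvar x = y" by (simp add: yvar_def)
  ultimately show "x \<in> slit_plane" unfolding slit_plane_iff by simp
qed

lemma open_slit_plane: "open slit_plane"
proof -
  have "continuous_on UNIV yvar" unfolding yvar_def by (intro continuous_intros) auto
  then have "open (yvar -` (- \<real>\<^sub>\<le>\<^sub>0))" by (intro open_vimage) auto
  moreover have "yvar -` (- \<real>\<^sub>\<le>\<^sub>0) = slit_plane" by (auto simp: slit_plane_iff)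
  ultimately show ?thesis by simp
qed

lemma connected_slit_plane: "connected slit_plane"
proof -
  have "(\<real>\<^sub>\<le>\<^sub>0 :: complex set) = of_real ` {..0}"
    by (auto elim!: nonpos_Reals_cases)
  then have "connected (- \<real>\<^sub>\<le>\<^sub>0 :: complex set)"
    using starlike_imp_connected[OF starlike_slotted_complex_plane_left[of 0]] by simp
  then show ?thesis
    unfolding slit_plane_eq_image by (intro connected_continuous_image continuous_intros)
qed

lemma scaled_yvar_nonpos_iff:
  assumes "c > 0"
  shows "of_real c * yvar x \<in> \<real>\<^sub>\<le>\<^sub>0 \<longleftrightarrow> yvar x \<in> \<real>\<^sub>\<le>\<^sub>0"
  using assms by (auto simp: complex_nonpos_Reals_iff mult_le_0_iff)

text \<open>The first quadrant in \<open>x\<close> is the fourth quadrant in \<open>yvar x\<close>,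
  where the integral formula holds, and the extension to the slit plane is unique. The factor
  \<open>s\<close> carries the sign of R_n, the factor \<open>c\<close> the scaling by
  \<open>2 ^ k\<close>.\<close>

lemma analytic_extension_eq_remainder:
  assumes e: "e \<in> quarter_arc" and n: "n \<ge> 1" and c: "c > 0"
    and f: "\<And>x. x \<in> open_first_quadrant \<Longrightarrow> f x = s * remainder_int e n (of_real c * yvar x)"
    and x: "x \<in> slit_plane"
  shows "analytic_extension open_first_quadrant slit_plane f x = s * remainder e n (of_real c * yvar x)"
proof (rule analytic_extension_eq[OF open_slit_plane connected_slit_plane _ _ _ _ _ x])
  show "open open_first_quadrant"
    unfolding open_first_quadrant_def Collect_conj_eq
    by (intro open_Int open_halfspace_Re_gt open_halfspace_Im_gt)
  have "Complex 1 1 \<in> open_first_quadrant" by (simp add: open_first_quadrant_def)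
  then show "open_first_quadrant \<noteq> {}" by blast
  have quadrant: "Re (of_real c * yvar w) > 0" if "w \<in> open_first_quadrant" for w
    using that c by (simp add: open_first_quadrant_def yvar_def)
  have not_neg: "of_real c * yvar w \<notin> \<real>\<^sub>\<le>\<^sub>0" if "w \<in> open_first_quadrant" for w
    using quadrant[OF that] by (auto simp: complex_nonpos_Reals_iff)
  then show "open_first_quadrant \<subseteq> slit_plane"
    using c by (auto simp: slit_plane_iff scaled_yvar_nonpos_iff)
  have "yvar holomorphic_on slit_plane"
    unfolding yvar_def by (intro holomorphic_intros) auto
  then have "(\<lambda>x. of_real c * yvar x) holomorphic_on slit_plane"
    by (intro holomorphic_intros)
  then have "(remainder e n \<circ> (\<lambda>x. of_real c * yvar x)) holomorphic_on slit_plane"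
    by (rule holomorphic_on_compose_gen[OF _ holomorphic_remainder[OF e n]])
      (use c in \<open>auto simp: slit_plane_iff scaled_yvar_nonpos_iff\<close>)
  then show "(\<lambda>x. s * remainder e n (of_real c * yvar x)) holomorphic_on slit_plane"
    by (intro holomorphic_intros) (simp add: o_def)
  show "s * remainder e n (of_real c * yvar w) = f w" if "w \<in> open_first_quadrant" for w
  proof -
    have "remainder e n (of_real c * yvar w) = remainder_int e n (of_real c * yvar w)"
      by (rule remainder_eq_remainder_int[OF e n not_neg[OF that]]) (use quadrant[OF that] n in linarith)
    then show ?thesis using f[OF that] by simp
  qed
qed

section \<open>Identification of the two families of remainders\<close>

lemma one_in_quarter_arc: "1 \<in> quarter_arc"
  by (simp add: quarter_arc_def)

text \<open>From \<open>k = 1\<close> on the angle \<open>pi / 2 ^ k\<close> is at most a right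
  angle; for \<open>k = 0\<close> the point would be \<open>-1\<close>.\<close>

lemma ek_in_quarter_arc:
  assumes "k \<ge> 1"
  shows "ek k \<in> quarter_arc"
proof -
  define \<phi> where "\<phi> = pi / 2 ^ k"
  have "ek k = cis (- \<phi>)" by (simp add: ek_def \<phi>_def cis_conv_exp)
  moreover have "0 \<le> \<phi>" by (simp add: \<phi>_def)
  moreover have "\<phi> \<le> pi / 2"
    unfolding \<phi>_def using power_increasing[of 1 k "2 :: real"] assms by (intro divide_left_mono) auto
  ultimately show ?thesis by (simp add: quarter_arc_def cos_ge_zero sin_ge_zero)
qed

lemma R_eq_remainder:
  assumes "n \<ge> 1" "x \<in> slit_plane"
  shows "R n x = - remainder 1 n (yvar x)"
proof -
  have "R_integral n w = - 1 * remainder_int 1 n (of_real 1 * yvar w)" if "w \<in> open_first_quadrant" for w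
    using quadrant_integral_eq_remainder_int[OF one_in_quarter_arc assms(1), of "yvar w"] that
    by (simp add: R_integral_def yvar_def open_first_quadrant_def)
  from analytic_extension_eq_remainder[OF one_in_quarter_arc assms(1) _ this assms(2)] show ?thesis
    by (simp add: R_def)
qed

lemma Rk_eq_remainder:
  assumes "n \<ge> 1" "k \<ge> 1" "x \<in> slit_plane"
  shows "Rk n k x = remainder (ek k) n (2 ^ k * yvar x)"
proof -
  have "Rk_integral n k w = 1 * remainder_int (ek k) n (of_real (2 ^ k) * yvar w)"
    if "w \<in> open_first_quadrant" for w
    using quadrant_integral_eq_remainder_int[OF ek_in_quarter_arc[OF assms(2)] assms(1), of "2 ^ k * yvar w"] that
    by (simp add: Rk_integral_def yvar_def open_first_quadrant_def)
  from analytic_extension_eq_remainder[OF ek_in_quarter_arc[OF assms(2)] assms(1) _ this assms(3)]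
  show ?thesis by (simp add: Rk_def)
qed

section \<open>Transfer of the sector bound to the variable \<open>x\<close>\<close>

lemma Arg_scaled_yvar: "c > 0 \<Longrightarrow> Arg (of_real c * yvar x) = Arg (- \<i> * x)"
  using Arg_times_of_real[of "c / pi" "- \<i> * x"] by (simp add: yvar_def)

lemma closed_sector_subset_slit_plane:
  assumes "\<delta> > 0"
  shows "closed_sector \<delta> \<subseteq> slit_plane"
proof
  fix x assume x: "x \<in> closed_sector \<delta>"
  have "yvar x \<notin> \<real>\<^sub>\<le>\<^sub>0"
  proof
    assume "yvar x \<in> \<real>\<^sub>\<le>\<^sub>0"
    moreover have "yvar x \<noteq> 0" using x by (simp add: yvar_def closed_sector_def)
    ultimately have "Arg (yvar x) = pi"
      by (auto simp: Arg_eq_pi complex_nonpos_Reals_iff complex_eq_iff)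
    then have "Arg (- \<i> * x) = pi" using Arg_scaled_yvar[of 1 x] by simp
    then show False using x assms by (simp add: closed_sector_def)
  qed
  then show "x \<in> slit_plane" by (simp add: slit_plane_iff)
qed

text \<open>The modulus of \<open>c * yvar x\<close> is that of \<open>c * x\<close> divided by
  \<open>pi\<close>, which changes the threshold by \<open>pi\<close> and the constant by
  \<open>pi ^ n\<close>. One constant serves all \<open>e\<close> and \<open>c\<close>, whence the
  uniformity in \<open>k\<close>.\<close>

lemma scaled_remainder_sector_bound:
  assumes n: "n \<ge> 1" and \<delta>: "\<delta> > 0"
  obtains C where "\<And>e c x. \<lbrakk>e \<in> quarter_arc; c > 0; x \<in> closed_sector \<delta>; norm (of_real c * x) \<ge> 2 * real n * pi\<rbrakk> \<Longrightarrow>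
    norm (remainder e n (of_real c * yvar x)) \<le> C * norm (1 / (of_real c * x) ^ n)"
proof -
  obtain C where C: "\<And>e z. \<lbrakk>e \<in> quarter_arc; z \<noteq> 0; \<bar>Arg z\<bar> \<le> pi - \<delta>; norm z \<ge> 2 * real n\<rbrakk> \<Longrightarrow>
      norm (remainder e n z) \<le> C / norm z ^ n"
    using remainder_sector_bound[OF n \<delta>] by blast
  show ?thesis
  proof (rule that)
    fix e x :: complex and c :: real
    assume e: "e \<in> quarter_arc" and c: "c > 0" and x: "x \<in> closed_sector \<delta>"
      and large: "norm (of_real c * x) \<ge> 2 * real n * pi"
    let ?z = "of_real c * yvar x"
    have norm_z: "norm ?z = norm (of_real c * x) / pi"
      by (simp add: yvar_def norm_mult norm_divide)
    have "norm (remainder e n ?z) \<le> C / norm ?z ^ n"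
    proof (rule C[OF e])
      show "?z \<noteq> 0" using x c by (simp add: yvar_def closed_sector_def)
      show "\<bar>Arg ?z\<bar> \<le> pi - \<delta>"
        unfolding Arg_scaled_yvar[OF c] using x by (simp add: closed_sector_def)
      show "norm ?z \<ge> 2 * real n" unfolding norm_z using large by (simp add: field_simps)
    qed
    also have "\<dots> = C * pi ^ n * norm (1 / (of_real c * x) ^ n)"
      unfolding norm_z by (simp add: norm_divide norm_power power_divide)
    finally show "norm (remainder e n ?z) \<le> C * pi ^ n * norm (1 / (of_real c * x) ^ n)" .
  qed
qed

theorem proposition1:
  shows
    "(\<forall>x \<in> slit_plane.
        (\<lambda>n. R n x) \<in> O(\<lambda>n. complex_of_real ((1 / 2) ^ n * real n powr (- Im x / pi)))) \<and>
     (\<forall>n \<ge> 1. \<forall>\<delta> > 0.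
        R n \<in> O[inf at_infinity (principal (closed_sector \<delta>))](\<lambda>x. 1 / x ^ n)) \<and>
     (\<forall>k \<ge> 1. \<forall>x \<in> slit_plane.
        (\<lambda>n. Rk n k x) \<in>
          O(\<lambda>n. complex_of_real ((1 / norm (1 + ek k)) ^ n * real n powr (- (2 ^ k) * Im x / pi)))) \<and>
     (\<forall>n \<ge> 1. \<forall>\<delta> > 0.
        (\<lambda>(k, x). Rk n k x) \<in>
          O[inf (filtercomap (\<lambda>(k, x). 2 ^ k * x) at_infinity)
                (principal ({1..} \<times> closed_sector \<delta>))](\<lambda>(k, x). 1 / (2 ^ k * x) ^ n))"
proof (intro conjI ballI allI impI)
  fix x assume x: "x \<in> slit_plane"
  \<comment> \<open>Here \<open>norm (1 + 1) = 2\<close> and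
    \<open>Re (yvar x) = Im x / pi\<close>.\<close>
  have "(\<lambda>n. - remainder 1 n (yvar x)) \<in>
      O(\<lambda>n. complex_of_real ((1 / 2) ^ n * real n powr (- Im x / pi)))"
    using remainder_large_n[OF one_in_quarter_arc, of "yvar x"] x
    by (simp add: slit_plane_iff yvar_def)
  \<comment> \<open>The identification starts at \<open>n = 1\<close>, so the two sequences are only
    claimed to agree eventually.\<close>
  moreover have "\<forall>\<^sub>F n in sequentially. R n x = - remainder 1 n (yvar x)"
    using eventually_ge_at_top[of 1] by eventually_elim (rule R_eq_remainder[OF _ x])
  ultimately show "(\<lambda>n. R n x) \<in> O(\<lambda>n. complex_of_real ((1 / 2) ^ n * real n powr (- Im x / pi)))"
    by (simp add: landau_o.big.in_cong)
next
  fix n :: nat and \<delta> :: real assume n: "n \<ge> 1" and \<delta>: "\<delta> > 0"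
  \<comment> \<open>The same constant settles both large-argument estimates, with
    \<open>c = 1\<close> and with \<open>c = 2 ^ k\<close>.\<close>
  obtain C where C: "\<And>e c x. \<lbrakk>e \<in> quarter_arc; c > 0; x \<in> closed_sector \<delta>; norm (of_real c * x) \<ge> 2 * real n * pi\<rbrakk> \<Longrightarrow>
      norm (remainder e n (of_real c * yvar x)) \<le> C * norm (1 / (of_real c * x) ^ n)"
    using scaled_remainder_sector_bound[OF n \<delta>] by blast
  show "R n \<in> O[inf at_infinity (principal (closed_sector \<delta>))](\<lambda>x. 1 / x ^ n)"
  proof (rule bigoI[where c = C])
    have "norm (R n x) \<le> C * norm (1 / x ^ n)"
      if "norm x \<ge> 2 * real n * pi" "x \<in> closed_sector \<delta>" for x
      using C[OF one_in_quarter_arc, of 1 x] that R_eq_remainder[OF n, of x]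
        closed_sector_subset_slit_plane[OF \<delta>] by auto
    then show "\<forall>\<^sub>F x in inf at_infinity (principal (closed_sector \<delta>)). norm (R n x) \<le> C * norm (1 / x ^ n)"
      unfolding eventually_inf_principal eventually_at_infinity by blast
  qed
  show "(\<lambda>(k, x). Rk n k x) \<in>
      O[inf (filtercomap (\<lambda>(k, x). 2 ^ k * x) at_infinity)
        (principal ({1..} \<times> closed_sector \<delta>))](\<lambda>(k, x). 1 / (2 ^ k * x) ^ n)"
  proof (rule bigoI[where c = C])
    have bound: "norm (Rk n k x) \<le> C * norm (1 / (2 ^ k * x) ^ n)"
      if "norm (2 ^ k * x) \<ge> 2 * real n * pi" "k \<ge> 1" "x \<in> closed_sector \<delta>" for k x
      using C[OF ek_in_quarter_arc[OF that(2)], of "2 ^ k" x] that Rk_eq_remainder[OF n that(2), of x]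
        closed_sector_subset_slit_plane[OF \<delta>] by auto
    \<comment> \<open>The filter controls only the product \<open>2 ^ k * x\<close>, so a threshold
      independent of \<open>k\<close> is pulled back along this map.\<close>
    have "\<forall>\<^sub>F w :: complex in at_infinity. norm w \<ge> 2 * real n * pi"
      unfolding eventually_at_infinity by blast
    then have "eventually (\<lambda>p. norm ((\<lambda>(k, x). 2 ^ k * x :: complex) p) \<ge> 2 * real n * pi)
        (filtercomap (\<lambda>(k, x). 2 ^ k * x) at_infinity)"
      by (rule eventually_filtercomapI)
    then show "\<forall>\<^sub>F p in inf (filtercomap (\<lambda>(k, x). 2 ^ k * x) at_infinity)
          (principal ({1..} \<times> closed_sector \<delta>)).
        norm (case p of (k, x) \<Rightarrow> Rk n k x) \<le> C * norm (case p of (k, x) \<Rightarrow> 1 / (2 ^ k * x) ^ n)"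
      unfolding eventually_inf_principal
      by eventually_elim (use bound in auto)
  qed
next
  fix k :: nat and x assume k: "k \<ge> 1" and x: "x \<in> slit_plane"
  have "2 ^ k * yvar x \<notin> \<real>\<^sub>\<le>\<^sub>0"
    using x scaled_yvar_nonpos_iff[of "2 ^ k" x] by (simp add: slit_plane_iff)
  then have "(\<lambda>n. remainder (ek k) n (2 ^ k * yvar x)) \<in>
      O(\<lambda>n. complex_of_real ((1 / norm (1 + ek k)) ^ n * real n powr (- Re (2 ^ k * yvar x))))"
    by (rule remainder_large_n[OF ek_in_quarter_arc[OF k]])
  moreover have "- Re (2 ^ k * yvar x) = - (2 ^ k) * Im x / pi"
  proof -
    have "2 ^ k * yvar x = of_real (2 ^ k) * yvar x" by simp
    then show ?thesis
      by (simp only: times_complex.sel Re_complex_of_real Im_complex_of_real) (simp add: yvar_def)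
  qed
  moreover have "\<forall>\<^sub>F n in sequentially. Rk n k x = remainder (ek k) n (2 ^ k * yvar x)"
    using eventually_ge_at_top[of 1] by eventually_elim (rule Rk_eq_remainder[OF _ k x])
  ultimately show "(\<lambda>n. Rk n k x) \<in>
      O(\<lambda>n. complex_of_real ((1 / norm (1 + ek k)) ^ n * real n powr (- (2 ^ k) * Im x / pi)))"
    by (simp add: landau_o.big.in_cong)
qed

end
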